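(* Let $a_1,a_2:[0,\infty)\to[0,\infty)$ be continuous. Let $f_1,f_2:[0,\infty)\to[0,\infty)$ be continuous and increasing, with $f_1(0)\cdot f_2(0)\ge 0$ and $f_1(s_1)\cdot f_2(s_2)>0$ for all $s_1,s_2>0$. Let $M_1\ge\max\{1,\beta/\overline{\theta}_2(f_2(\alpha))\}$ and $M_2\ge\max\{1,\alpha/\overline{\theta}_1(f_1(\beta))\}$, and suppose there are constants $\overline{c}_1,\overline{c}_2>0$, continuous increasing functions $g_1,g_2:[0,\infty)\to[0,\infty)$ and continuous functions $\overline{\xi}_1,\overline{\xi}_2:[0,\infty)\to[0,\infty)$ such that $$f_1(t_1w_1)\le\overline{c}_1\,g_1(t_1)\,\overline{\xi}_1(w_1)\quad\text{for all } w_1\ge1,\ t_1\ge M_1\overline{\theta}_2(f_2(\alpha)),$$ $$f_2(t_2w_2)\le\overline{c}_2\,g_2(t_2)\,\overline{\xi}_2(w_2)\quad\text{for all } w_2\ge1,\ t_2\ge M_2\overline{\theta}_1(f_1(\beta)).$$ Assume $H_{1,2}(\infty)=H_{2,1}(\infty)=\infty$. Then the system $$\Delta_{\phi_1}u=a_1(|x|)f_1(v),\qquad \Delta_{\phi_2}v=a_2(|x|)f_2(u),\qquad x\in\mathbb{R}^N,$$ has one positive radial solution $(u,v)\in C^1([0,\infty))\times C^1([0,\infty))$ with $(u(0),v(0))=(\alpha,\beta)$. Moreover, the following hold. 1) Suppose in addition that there are $\underline{c}_2\in(0,\infty)$ and a continuous $\underline{\xi}_2:[0,\infty)\to[0,\infty)$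 with $f_2(m_2w_2)\ge\underline{c}_2\,\underline{\xi}_2(w_2)$ for all $w_2\ge1$, where $m_2\in(0,\min\{\alpha,\underline{\theta}_1(f_1(\beta))\})$, and that $\overline{P}_{1,2}(\infty)<\infty$ and $\underline{P}_{2,1}(\infty)=\infty$. Then $\lim_{r\to\infty}u(r)<\infty$ and $\lim_{r\to\infty}v(r)=\infty$. 2) Suppose in addition that there are $\underline{c}_1\in(0,\infty)$ and a continuous $\underline{\xi}_1:[0,\infty)\to[0,\infty)$ with $f_1(m_1w_1)\ge\underline{c}_1\,\underline{\xi}_1(w_1)$ for all $w_1\ge1$, where $m_1\in(0,\min\{\beta,\underline{\theta}_2(f_2(\alpha))\})$, and that $\underline{P}_{1,2}(\infty)=\infty$ and $\overline{P}_{2,1}(\infty)<\infty$. Then $\lim_{r\to\infty}u(r)=\infty$ and $\lim_{r\to\infty}v(r)<\infty$.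
   Context: Standing setting. $N\ge3$ is an integer and $\alpha,\beta\in(0,\infty)$ are arbitrary parameters. $\Delta_{\phi_i}u:=\operatorname{div}(\phi_i(|\nabla u|)\nabla u)$, $i=1,2$, where: - $\phi_i\in C^1((0,\infty),(0,\infty))$ and $\lim_{t\to0}t\phi_i(t)=0$; - $t\phi_i(t)>0$ is strictly increasing for $t>0$; - $h_i^{-1}$ is the inverse function of $h_i(t)=t\phi_i(t)$, $t>0$ (with $h_i^{-1}(0)=0$), and there exist constants $\underline{k}_i,\overline{k}_i>0$, continuous increasing functions $\underline{\theta}_i,\overline{\theta}_i:[0,\infty)\to[0,\infty)$ and continuous functions $\underline{\psi}_i,\overline{\psi}_i:[0,\infty)\to[0,\infty)$ (all fixed) such that $\underline{k}_i\underline{\theta}_i(s_1)\underline{\psi}_i(s_2)\le h_i^{-1}(s_1s_2)\le\overline{k}_i\overline{\theta}_i(s_1)\overline{\psi}_i(s_2)$ for all $s_1,s_2>0$. A radial solution is a pair of functions of $r=|x|$; radial solutions correspond to solutions on $[0,\infty)$ of $(r^{N-1}\phi_1(|u'|)u')'=r^{N-1}a_1(r)f_1(v)$, $(r^{N-1}\phi_2(|v'|)v')'=r^{N-1}a_2(r)f_2(u)$ with $u'(0)=v'(0)=0$. Notation, in terms of the data in the claim: $$\overline{\mathcal{A}}_{a_i}(t)=\int_0^t\overline{k}_i\overline{\psi}_i\Big(s^{1-N}\int_0^sz^{N-1}a_i(z)dz\Big)ds,\qquad \underline{\mathcal{A}}_{a_i}(t)=\int_0^t\underline{k}_i\underline{\psi}_i\Big(s^{1-N}\int_0^sz^{N-1}a_i(z)dz\Big)ds,$$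 $$\overline{P}_{1,2}(r)=\int_0^r\overline{\psi}_1\Big(\overline{c}_1y^{1-N}\int_0^yt^{N-1}a_1(t)\overline{\xi}_1(1+\overline{\mathcal{A}}_{a_2}(t))dt\Big)dy,$$ $$\overline{P}_{2,1}(r)=\int_0^r\overline{\psi}_2\Big(\overline{c}_2y^{1-N}\int_0^yt^{N-1}a_2(t)\overline{\xi}_2(1+\overline{\mathcal{A}}_{a_1}(t))dt\Big)dy,$$ $$\underline{P}_{1,2}(r)=\int_0^rh_1^{-1}\Big(\underline{c}_1y^{1-N}\int_0^yt^{N-1}a_1(t)\underline{\xi}_1(1+\underline{\mathcal{A}}_{a_2}(t))dt\Big)dy,$$ $$\underline{P}_{2,1}(r)=\int_0^rh_2^{-1}\Big(\underline{c}_2y^{1-N}\int_0^yt^{N-1}a_2(t)\underline{\xi}_2(1+\underline{\mathcal{A}}_{a_1}(t))dt\Big)dy,$$ $$H_{1,2}(r)=\int_\alpha^r\frac{dt}{\overline{\theta}_1(g_1(M_1\overline{\theta}_2(f_2(t))))},\qquad H_{2,1}(r)=\int_\beta^r\frac{dt}{\overline{\theta}_2(g_2(M_2\overline{\theta}_1(f_1(t))))},$$ and for each of these functions $F$, $F(\infty):=\lim_{r\to\infty}F(r)$. *)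

theory Defs
  imports "HOL-Analysis.Analysis"
begin

definition nonneg_cont :: "(real \<Rightarrow> real) \<Rightarrow> bool" where
  "nonneg_cont f \<longleftrightarrow> continuous_on {0..} f \<and> (\<forall>t\<ge>0. 0 \<le> f t)"

(* "Increasing" without "strictly" is read in the weak sense. *)
definition nonneg_cont_incr :: "(real \<Rightarrow> real) \<Rightarrow> bool" where
  "nonneg_cont_incr f \<longleftrightarrow> nonneg_cont f \<and> mono_on {0..} f"

definition h_of :: "(real \<Rightarrow> real) \<Rightarrow> real \<Rightarrow> real" where
  "h_of \<phi> t = t * \<phi> t"

definition hinv :: "(real \<Rightarrow> real) \<Rightarrow> real \<Rightarrow> real" where
  "hinv \<phi> s = (if s = 0 then 0 else inv_into {0<..} (h_of \<phi>) s)"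

(* The two-sided bound is required at every product s1 * s2 with s1, s2 > 0, so the inverse of
   h has to be defined on all of (0,oo); this is the surjectivity clause. *)
definition admissible_phi ::
  "(real \<Rightarrow> real) \<Rightarrow> real \<Rightarrow> real \<Rightarrow> (real \<Rightarrow> real) \<Rightarrow> (real \<Rightarrow> real)
    \<Rightarrow> (real \<Rightarrow> real) \<Rightarrow> (real \<Rightarrow> real) \<Rightarrow> bool" where
  "admissible_phi \<phi> kl ku \<theta>l \<theta>u \<psi>l \<psi>u \<longleftrightarrow>
     (\<forall>t>0. 0 < \<phi> t) \<and> \<phi> C1_differentiable_on {0<..} \<and>
     ((\<lambda>t. t * \<phi> t) \<longlongrightarrow> 0) (at_right 0) \<and>
     strict_mono_on {0<..} (h_of \<phi>) \<and>
     h_of \<phi> ` {0<..} = {0<..} \<and>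
     0 < kl \<and> 0 < ku \<and>
     nonneg_cont_incr \<theta>l \<and> nonneg_cont_incr \<theta>u \<and>
     nonneg_cont \<psi>l \<and> nonneg_cont \<psi>u \<and>
     (\<forall>s1>0. \<forall>s2>0. kl * \<theta>l s1 * \<psi>l s2 \<le> hinv \<phi> (s1 * s2) \<and>
                      hinv \<phi> (s1 * s2) \<le> ku * \<theta>u s1 * \<psi>u s2)"

(* In the integrals below, the inner quotient y^(1-N) * (integral over [0,y]) evaluates to 0 at
   y = 0, which is also its limit as y tends to 0 when N >= 1 and the integrand is continuous. *)
definition A_fun ::
  "nat \<Rightarrow> real \<Rightarrow> (real \<Rightarrow> real) \<Rightarrow> (real \<Rightarrow> real) \<Rightarrow> real \<Rightarrow> real" where
  "A_fun N k \<psi> a t =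
     integral {0..t} (\<lambda>s. k * \<psi> (s powi (1 - int N) * integral {0..s} (\<lambda>z. z ^ (N - 1) * a z)))"

(* w stands for an upper psi-function or for the inverse of h; A for an A_fun. *)
definition P_fun ::
  "nat \<Rightarrow> (real \<Rightarrow> real) \<Rightarrow> real \<Rightarrow> (real \<Rightarrow> real) \<Rightarrow> (real \<Rightarrow> real) \<Rightarrow> (real \<Rightarrow> real)
    \<Rightarrow> real \<Rightarrow> real" where
  "P_fun N w c a \<xi> A r =
     integral {0..r} (\<lambda>y. w (c * y powi (1 - int N) *
       integral {0..y} (\<lambda>t. t ^ (N - 1) * a t * \<xi> (1 + A t))))"

(* This agrees with the oriented integral from x0 to r only for r >= x0; it is used only in the
   limit r to infinity. *)
definition H_fun ::
  "real \<Rightarrow> (real \<Rightarrow> real) \<Rightarrow> (real \<Rightarrow> real) \<Rightarrow> real \<Rightarrow> (real \<Rightarrow> real) \<Rightarrow> (real \<Rightarrow> real)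
    \<Rightarrow> real \<Rightarrow> real" where
  "H_fun x0 \<theta> g M \<theta>' f r = integral {x0..r} (\<lambda>t. 1 / \<theta> (g (M * \<theta>' (f t))))"

definition grad :: "('a::real_inner \<Rightarrow> real) \<Rightarrow> 'a \<Rightarrow> 'a" where
  "grad U x = (THE D. GDERIV U x :> D)"

definition divergence :: "(real ^ 'n \<Rightarrow> real ^ 'n) \<Rightarrow> real ^ 'n \<Rightarrow> real" where
  "divergence F x = trace (jacobian F (at x))"

(* phi is only meaningful on (0,oo). Where the gradient vanishes the flux is 0 whatever the value
   of phi at 0, in accordance with t * phi(t) --> 0. *)
definition phi_flux :: "(real \<Rightarrow> real) \<Rightarrow> (real ^ 'n \<Rightarrow> real) \<Rightarrow> real ^ 'n \<Rightarrow> real ^ 'n" where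
  "phi_flux \<phi> U x = \<phi> (norm (grad U x)) *\<^sub>R grad U x"

definition phi_Laplacian :: "(real \<Rightarrow> real) \<Rightarrow> (real ^ 'n \<Rightarrow> real) \<Rightarrow> real ^ 'n \<Rightarrow> real" where
  "phi_Laplacian \<phi> U x = divergence (phi_flux \<phi> U) x"

definition solves_system ::
  "(real \<Rightarrow> real) \<Rightarrow> (real \<Rightarrow> real) \<Rightarrow> (real \<Rightarrow> real) \<Rightarrow> (real \<Rightarrow> real)
    \<Rightarrow> (real \<Rightarrow> real) \<Rightarrow> (real \<Rightarrow> real) \<Rightarrow> (real ^ 'n \<Rightarrow> real) \<Rightarrow> (real ^ 'n \<Rightarrow> real) \<Rightarrow> bool" where
  "solves_system \<phi>1 \<phi>2 a1 a2 f1 f2 U V \<longleftrightarrow>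
     (\<forall>x. U differentiable (at x) \<and> V differentiable (at x) \<and>
          phi_flux \<phi>1 U differentiable (at x) \<and> phi_flux \<phi>2 V differentiable (at x) \<and>
          phi_Laplacian \<phi>1 U x = a1 (norm x) * f1 (V x) \<and>
          phi_Laplacian \<phi>2 V x = a2 (norm x) * f2 (U x))"

(* The profiles are C^1 on [0,oo); derivatives at the endpoint 0 are one-sided. *)
definition solves_radial_system ::
  "nat \<Rightarrow> (real \<Rightarrow> real) \<Rightarrow> (real \<Rightarrow> real) \<Rightarrow> (real \<Rightarrow> real) \<Rightarrow> (real \<Rightarrow> real)
    \<Rightarrow> (real \<Rightarrow> real) \<Rightarrow> (real \<Rightarrow> real) \<Rightarrow> (real \<Rightarrow> real) \<Rightarrow> (real \<Rightarrow> real) \<Rightarrow> bool" where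
  "solves_radial_system N \<phi>1 \<phi>2 a1 a2 f1 f2 u v \<longleftrightarrow>
     (\<exists>u' v'.
        continuous_on {0..} u' \<and> continuous_on {0..} v' \<and> u' 0 = 0 \<and> v' 0 = 0 \<and>
        (\<forall>r\<ge>0.
           (u has_real_derivative u' r) (at r within {0..}) \<and>
           (v has_real_derivative v' r) (at r within {0..}) \<and>
           ((\<lambda>s. s ^ (N - 1) * \<phi>1 \<bar>u' s\<bar> * u' s) has_real_derivative
              r ^ (N - 1) * a1 r * f1 (v r)) (at r within {0..}) \<and>
           ((\<lambda>s. s ^ (N - 1) * \<phi>2 \<bar>v' s\<bar> * v' s) has_real_derivative
              r ^ (N - 1) * a2 r * f2 (u r)) (at r within {0..})))"

end

theory Submission
  imports Defs
begin

text \<open>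
  Integrating the two radial equations from 0 turns the system into a fixed-point problem. Write
  $Q_i[x](r) = r^{1-N}\int_0^r s^{N-1} a_i(s) f_i(x(s))\,ds$ (\<open>radial_flux\<close>). A pair of nonnegative
  continuous functions is a radial solution with central values \<open>\<alpha>\<close>, \<open>\<beta>\<close> as soon as $u = T_1 v$ and $v = T_2 u$, where
  $T_1 v(r) = \alpha + \int_0^r h_1^{-1}(Q_1[v])$ and $T_2 u(r) = \beta + \int_0^r h_2^{-1}(Q_2[u])$
  (\<open>radial_op\<close>). Since $f_i$ and $h_i^{-1}$ are increasing, $T_1$ and $T_2$ preserve order, so the iterates
  $u_{n+1} = T_1 T_2 u_n$ that start at the constant \<open>\<alpha>\<close> increase with $n$. By dominated convergence
  (\<open>radial_op_tendsto\<close>) they converge to a solution once they are bounded on every interval $[0,r]$.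

  The bound is of Keller-Osserman type and is proved for every \<open>v\<close> with $v \le T_2 T_1 v$, which covers
  the iterates and the solution at once. As $u = T_1 v$ is nondecreasing, the factor $f_2(u(r))$ can be
  taken out of the integrals that define $T_2 u(r)$, and the upper bound for $h_2^{-1}$ gives
  $v \le \beta + \overline\theta_2(f_2(u))\,\overline A \le M_1 \overline\theta_2(f_2(u))\,(1 + \overline A)$.
  The hypothesis on $f_1$ splits $f_1$ of this product, and the upper bound for $h_1^{-1}$ then yields
  $u' \le \overline k_1\,\overline\theta_1(g_1(M_1\overline\theta_2(f_2(u))))\,p$, where $p$ is the integrand of
  $\overline P_{1,2}$ (\<open>slope_le_growth\<close>). Separating variables, $H_{1,2}(u(r)) \le \overline k_1 \overline P_{1,2}(r)$
  (\<open>H_op_le_P\<close>). Because $H_{1,2}(\infty) = \infty$, this bounds $u$ on compact intervals, and on the whole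
  half-line if $\overline P_{1,2}(\infty) < \infty$.

  Conversely $v \ge \beta$ and the lower bound for $h_1^{-1}$ give
  $u \ge \alpha + \underline\theta_1(f_1(\beta))\,\underline A \ge m_2 (1 + \underline A)$, so that
  $v \ge \underline P_{2,1}$, which tends to infinity in the first case (\<open>second_component_at_top\<close>). The second
  case is the first one with the two equations exchanged.

  On $\mathbb{R}^N$ the flux of the profile \<open>u\<close> is the vector field $Q(|x|)\,x/|x|$, and its divergence is
  the source term, also at the origin because $Q(r)/r$ has a limit there (\<open>radial_field_divergence\<close>).
\<close>

section \<open>Functions on the half-line\<close>

lemma at_within_atLeast: "(at (r::real) within {a..r + 1}) = (at r within {a..})"
  by (rule at_within_nhd[where S = "{..<r + 1}"]) auto

lemma at_within_atLeast_interior: "a < r \<Longrightarrow> (at (r::real) within {a..}) = at r"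
  by (rule at_within_interior) simp

lemma integral_has_real_derivative_atLeast:
  fixes g :: "real \<Rightarrow> real"
  assumes "continuous_on {a..} g" "a \<le> r"
  shows "((\<lambda>t. integral {a..t} g) has_real_derivative g r) (at r within {a..})"
proof -
  have "continuous_on {a..r + 1} g"
    using assms(1) by (rule continuous_on_subset) auto
  then have "((\<lambda>t. integral {a..t} g) has_real_derivative g r) (at r within {a..r + 1})"
    by (rule integral_has_real_derivative) (use assms in auto)
  then show ?thesis
    by (simp add: at_within_atLeast)
qed

lemma continuous_on_atLeast_integrable:
  fixes g :: "real \<Rightarrow> real"
  assumes "continuous_on {a..} g"
  shows "g integrable_on {a..r}"
  by (rule integrable_continuous_real) (rule continuous_on_subset[OF assms], auto)

lemma continuous_on_integral_atLeast:
  fixes g :: "real \<Rightarrow> real"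
  assumes "continuous_on {a..} g"
  shows "continuous_on {a..} (\<lambda>r. integral {a..r} g)"
  using integral_has_real_derivative_atLeast[OF assms]
  by (meson DERIV_continuous continuous_on_eq_continuous_within atLeast_iff)

lemma nonneg_contD:
  assumes "nonneg_cont x"
  shows "continuous_on {0..} x" "\<And>s. 0 \<le> s \<Longrightarrow> 0 \<le> x s"
  using assms by (auto simp: nonneg_cont_def)

lemma nonneg_cont_compose:
  assumes "nonneg_cont f" "nonneg_cont x"
  shows "nonneg_cont (\<lambda>s. f (x s))"
proof -
  have "continuous_on {0..} (\<lambda>s. f (x s))"
    by (rule continuous_on_compose2[of "{0..}" f]) (use assms in \<open>auto simp: nonneg_cont_def\<close>)
  then show ?thesis using assms by (simp add: nonneg_cont_def)
qed

lemma nonneg_cont_mult: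
  assumes "nonneg_cont f" "nonneg_cont x"
  shows "nonneg_cont (\<lambda>s. f s * x s)"
  using assms by (simp add: nonneg_cont_def continuous_on_mult)

lemma nonneg_cont_const: "0 \<le> c \<Longrightarrow> nonneg_cont (\<lambda>_. c)"
  by (auto simp: nonneg_cont_def)

lemma nonneg_cont_const_add:
  "0 \<le> c \<Longrightarrow> nonneg_cont x \<Longrightarrow> nonneg_cont (\<lambda>s. c + x s)"
  by (simp add: nonneg_cont_def continuous_on_add)

lemma nonneg_cont_const_mult:
  "0 \<le> c \<Longrightarrow> nonneg_cont x \<Longrightarrow> nonneg_cont (\<lambda>s. c * x s)"
  by (rule nonneg_cont_mult[OF nonneg_cont_const])

lemma nonneg_cont_integral:
  assumes "nonneg_cont x"
  shows "nonneg_cont (\<lambda>r. integral {0..r} x)"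
proof -
  have "0 \<le> integral {0..r} x" for r
    by (rule integral_nonneg[OF continuous_on_atLeast_integrable]) (use assms in \<open>auto simp: nonneg_cont_def\<close>)
  then show ?thesis
    using assms by (simp add: nonneg_cont_def continuous_on_integral_atLeast)
qed

lemma integral_mono_upper_limit:
  assumes "nonneg_cont x" "r \<le> s"
  shows "integral {0..r} x \<le> integral {0..s} x"
  using assms unfolding nonneg_cont_def
  by (intro integral_subset_le continuous_on_atLeast_integrable) auto

lemma nonneg_cont_incrD:
  assumes "nonneg_cont_incr f"
  shows "nonneg_cont f" "\<And>s t. 0 \<le> s \<Longrightarrow> s \<le> t \<Longrightarrow> f s \<le> f t" "\<And>s. 0 \<le> s \<Longrightarrow> 0 \<le> f s"
  using assms by (auto simp: nonneg_cont_incr_def nonneg_cont_def mono_on_def)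

lemma mono_bounded_tendsto_at_top:
  fixes u :: "real \<Rightarrow> real"
  assumes mono: "\<And>r s. 0 \<le> r \<Longrightarrow> r \<le> s \<Longrightarrow> u r \<le> u s" and bound: "\<And>r. 0 \<le> r \<Longrightarrow> u r \<le> B"
  shows "\<exists>L. (u \<longlongrightarrow> L) at_top"
proof
  let ?L = "SUP r\<in>{0..}. u r"
  have bdd: "bdd_above (u ` {0..})"
    using bound by (auto intro!: bdd_aboveI[of _ B])
  show "(u \<longlongrightarrow> ?L) at_top"
  proof (rule increasing_tendsto)
    show "\<forall>\<^sub>F r in at_top. u r \<le> ?L"
      using eventually_ge_at_top[of 0] by eventually_elim (auto intro: cSUP_upper bdd)
  next
    fix l assume "l < ?L"
    then obtain r where r: "0 \<le> r" "l < u r"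
      using less_cSUP_iff[OF _ bdd] by auto
    show "\<forall>\<^sub>F s in at_top. l < u s"
      using eventually_ge_at_top[of r] by eventually_elim (use r mono[of r] in force)
  qed
qed

section \<open>The radial flux\<close>

text \<open>The solution $w$ of $(r^{N-1} w)' = r^{N-1} b$ with $w(0) = 0$: for a radial source \<open>b\<close> in dimension \<open>N\<close>
  it is the outward flux density through the sphere of radius \<open>r\<close>.\<close>
definition radial_flux :: "nat \<Rightarrow> (real \<Rightarrow> real) \<Rightarrow> real \<Rightarrow> real" where
  "radial_flux N b r = r powi (1 - int N) * integral {0..r} (\<lambda>s. s ^ (N - 1) * b s)"

lemma radial_flux_0 [simp]: "radial_flux N b 0 = 0"
  by (simp add: radial_flux_def)

lemma power_mult_radial_flux:
  assumes "1 \<le> N" "0 \<le> r"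
  shows "r ^ (N - 1) * radial_flux N b r = integral {0..r} (\<lambda>s. s ^ (N - 1) * b s)"
proof (cases "r = 0")
  case False
  have "1 - int N = - int (N - 1)"
    using assms by simp
  then have "r powi (1 - int N) = inverse (r ^ (N - 1))"
    by (simp only: power_int_minus power_int_of_nat)
  with False show ?thesis by (simp add: radial_flux_def)
qed auto

lemma radial_flux_eq:
  assumes "1 \<le> N" "0 < r"
  shows "radial_flux N b r = integral {0..r} (\<lambda>s. s ^ (N - 1) * b s) / r ^ (N - 1)"
  using power_mult_radial_flux[of N r b] assms by (simp add: field_simps)

lemma continuous_on_weighted:
  "continuous_on {0..} b \<Longrightarrow> continuous_on {0..} (\<lambda>s::real. s ^ (N - 1) * b s :: real)"
  by (intro continuous_intros)

lemma radial_flux_mono: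
  assumes "0 \<le> r" "continuous_on {0..} b" "continuous_on {0..} c"
    and "\<And>s. 0 \<le> s \<Longrightarrow> s \<le> r \<Longrightarrow> b s \<le> c s"
  shows "radial_flux N b r \<le> radial_flux N c r"
  unfolding radial_flux_def using assms
  by (intro mult_left_mono integral_le continuous_on_atLeast_integrable continuous_on_weighted)
     (auto intro: zero_le_power_int)

lemma radial_flux_cmult: "radial_flux N (\<lambda>s. k * b s) r = k * radial_flux N b r"
proof -
  have "(\<lambda>s. s ^ (N - 1) * (k * b s)) = (\<lambda>s. k * (s ^ (N - 1) * b s))"
    by (simp add: ac_simps)
  then show ?thesis by (simp add: radial_flux_def)
qed

lemma radial_flux_const:
  assumes "1 \<le> N" "0 \<le> r"
  shows "radial_flux N (\<lambda>_. k) r = k * r / real N"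
proof (cases "r = 0")
  case False
  have "((\<lambda>s. s ^ (N - 1) * k) has_integral r ^ N / N * k - 0 ^ N / N * k) {0..r}"
    using assms
    by (intro fundamental_theorem_of_calculus)
       (auto intro!: derivative_eq_intros simp: has_real_derivative_iff_has_vector_derivative[symmetric])
  from integral_unique[OF this] have "integral {0..r} (\<lambda>s. s ^ (N - 1) * k) = r ^ N / N * k"
    using assms by (simp only: power_0_left) simp
  moreover have "r ^ N = r * r ^ (N - 1)"
    using assms by (cases N) auto
  ultimately show ?thesis
    using assms False by (simp add: radial_flux_eq)
qed auto

text \<open>Near 0 the function \<open>b\<close> lies between two constants close to $b(0)$, and the flux is monotone in \<open>b\<close> and
  explicit for constants. This limit is what makes the flux continuous at 0 and the corresponding vector
  field differentiable at the origin.\<close>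
lemma radial_flux_quotient_tendsto:
  assumes "1 \<le> N" "continuous_on {0..} b"
  shows "((\<lambda>r. radial_flux N b r / r) \<longlongrightarrow> b 0 / N) (at_right 0)"
proof (rule tendstoI)
  fix e :: real assume e: "0 < e"
  obtain d where d: "0 < d" "\<And>s. 0 \<le> s \<Longrightarrow> s < d \<Longrightarrow> \<bar>b s - b 0\<bar> < e / 2"
    using assms(2)[unfolded continuous_on_iff, rule_format, of 0 "e / 2"] e
    by (auto simp: dist_real_def)
  have near: "b 0 - e / 2 \<le> b s" "b s \<le> b 0 + e / 2" if "0 \<le> s" "s \<le> r" "r < d" for s r
  proof -
    have "\<bar>b s - b 0\<bar> < e / 2"
      using d(2) that by simp
    then show "b 0 - e / 2 \<le> b s" "b s \<le> b 0 + e / 2"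
      by linarith+
  qed
  have "dist (radial_flux N b r / r) (b 0 / N) < e" if r: "0 < r" "r < d" for r
  proof -
    have "radial_flux N (\<lambda>_. b 0 - e / 2) r \<le> radial_flux N b r"
         "radial_flux N b r \<le> radial_flux N (\<lambda>_. b 0 + e / 2) r"
      using r assms by (auto intro!: radial_flux_mono dest: near)
    then have "(b 0 - e / 2) / N \<le> radial_flux N b r / r" "radial_flux N b r / r \<le> (b 0 + e / 2) / N"
      using r assms by (auto simp: radial_flux_const field_simps)
    moreover have "e / 2 / N \<le> e / 2"
      using e assms by (auto simp: field_simps)
    ultimately show ?thesis
      using e by (simp add: dist_real_def add_divide_distrib diff_divide_distrib abs_less_iff)
  qed
  with d(1) show "\<forall>\<^sub>F r in at_right 0. dist (radial_flux N b r / r) (b 0 / N) < e"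
    by (auto simp: eventually_at_right_field)
qed

lemma weighted_integral_has_derivative:
  fixes b :: "real \<Rightarrow> real"
  assumes "1 \<le> N" "continuous_on {0..} b" "0 \<le> r"
  shows "((\<lambda>s. s ^ (N - 1) * radial_flux N b s) has_real_derivative r ^ (N - 1) * b r)
           (at r within {0..})"
  by (rule has_field_derivative_transform_within[OF
        integral_has_real_derivative_atLeast[OF continuous_on_weighted[OF assms(2)] assms(3)] zero_less_one])
     (use assms in \<open>simp_all add: power_mult_radial_flux del: One_nat_def\<close>)

lemma radial_flux_has_derivative:
  assumes "1 \<le> N" "continuous_on {0..} b" "0 < r"
  shows "(radial_flux N b has_real_derivative b r - (real N - 1) * radial_flux N b r / r) (at r)"
proof -
  let ?I = "\<lambda>r. integral {0..r} (\<lambda>s. s ^ (N - 1) * b s)"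
  have "(?I has_real_derivative r ^ (N - 1) * b r) (at r)"
    using integral_has_real_derivative_atLeast[OF continuous_on_weighted[OF assms(2)], of r N] assms(3)
    by (simp add: at_within_atLeast_interior)
  then have "((\<lambda>r. ?I r / r ^ (N - 1)) has_real_derivative
      (r ^ (N - 1) * b r * r ^ (N - 1) - ?I r * (real (N - 1) * r ^ (N - 1 - 1))) / (r ^ (N - 1) * r ^ (N - 1))) (at r)"
    using assms(3) by (auto intro!: derivative_eq_intros)
  moreover have "(r ^ (N - 1) * b r * r ^ (N - 1) - ?I r * (real (N - 1) * r ^ (N - 1 - 1))) / (r ^ (N - 1) * r ^ (N - 1))
     = b r - (real N - 1) * radial_flux N b r / r"
  proof (cases "N = 1")
    case False
    then obtain k where "N = Suc (Suc k)"
      using assms(1) by (metis One_nat_def not0_implies_Suc not_one_le_zero)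
    then show ?thesis using assms by (simp add: radial_flux_eq field_simps)
  qed (use assms in \<open>auto simp: radial_flux_eq\<close>)
  ultimately have "((\<lambda>r. ?I r / r ^ (N - 1)) has_real_derivative
      b r - (real N - 1) * radial_flux N b r / r) (at r)" by simp
  then show ?thesis
    by (rule has_field_derivative_transform_within_open[where S = "{0<..}"])
       (use assms in \<open>auto simp: radial_flux_eq\<close>)
qed

lemma nonneg_cont_radial_flux:
  assumes "1 \<le> N" "nonneg_cont b"
  shows "nonneg_cont (radial_flux N b)"
proof -
  have b: "continuous_on {0..} b" "\<And>s. 0 \<le> s \<Longrightarrow> 0 \<le> b s"
    using assms(2) by (auto simp: nonneg_cont_def)
  have "((\<lambda>r. radial_flux N b r / r * r) \<longlongrightarrow> b 0 / N * 0) (at_right 0)"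
    by (intro tendsto_mult radial_flux_quotient_tendsto b assms tendsto_ident_at)
  then have 0: "(radial_flux N b \<longlongrightarrow> 0) (at_right 0)"
    unfolding mult_zero_right
    by (rule Lim_transform_eventually) (auto intro: eventually_at_rightI[of 0 1])
  have "continuous (at r within {0..}) (radial_flux N b)" if "0 \<le> r" for r
  proof (cases "r = 0")
    case True
    with 0 show ?thesis by (simp add: continuous_within at_within_Ici_at_right)
  next
    case False
    with that show ?thesis
      using radial_flux_has_derivative[OF assms(1) b(1), of r]
      by (auto intro: continuous_at_imp_continuous_at_within DERIV_isCont)
  qed
  moreover have "0 \<le> radial_flux N b r" if "0 \<le> r" for r
    using radial_flux_mono[of r "\<lambda>_. 0" b N] b that assms(1) by (simp add: radial_flux_const)
  ultimately show ?thesis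
    by (auto simp: nonneg_cont_def continuous_on_eq_continuous_within)
qed

section \<open>Radial vector fields and their divergence\<close>

lemma filterlim_norm_at_right_0: "filterlim norm (at_right 0) (at (0 :: 'a::real_normed_vector))"
  using tendsto_norm_zero[OF tendsto_ident_at] by (simp add: filterlim_at eventually_at_filter)

text \<open>The norm has no derivative at the origin. There the vanishing slope of \<open>u\<close> takes over: the quotient
  $(u(|h|) - u(0))/|h|$ is the one-sided difference quotient of \<open>u\<close> at 0.\<close>
lemma GDERIV_radial:
  fixes x :: "'a::real_inner"
  assumes "(u has_real_derivative d) (at (norm x) within {0..})" and "x = 0 \<Longrightarrow> d = 0"
  shows "GDERIV (\<lambda>x. u (norm x)) x :> d *\<^sub>R sgn x"
proof (cases "x = 0")
  case True
  have "((\<lambda>r. (u r - u 0) / r) \<longlongrightarrow> 0) (at_right 0)"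
    using assms True by (simp add: has_field_derivative_iff at_within_Ici_at_right)
  then have "((\<lambda>h::'a. (u (norm h) - u 0) / norm h) \<longlongrightarrow> 0) (at 0)"
    by (rule filterlim_compose) (rule filterlim_norm_at_right_0)
  from tendsto_rabs[OF this] show ?thesis
    using True by (simp add: gderiv_def has_derivative_at abs_divide)
next
  case False
  then show ?thesis
    using assms(1) by (intro GDERIV_DERIV_compose GDERIV_norm) (simp_all add: at_within_atLeast_interior)
qed

lemma grad_eq: "GDERIV U x :> D \<Longrightarrow> grad U x = D"
  unfolding grad_def
proof (rule the_equality)
  fix D' assume "GDERIV U x :> D" "GDERIV U x :> D'"
  then have "(\<lambda>h. h \<bullet> D) = (\<lambda>h. h \<bullet> D')"
    unfolding gderiv_def by (rule has_derivative_unique)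
  from fun_cong[OF this[symmetric]] show "D' = D"
    using vector_eq_ldot[of D' D] by simp
qed

lemma divergence_eq:
  fixes F :: "real ^ 'n \<Rightarrow> real ^ 'n"
  assumes "(F has_derivative F') (at x)"
  shows "divergence F x = (\<Sum>i\<in>UNIV. F' (axis i 1) $ i)"
  using frechet_derivative_at[OF assms]
  by (simp add: divergence_def jacobian_def trace_def matrix_def)

text \<open>Away from the origin the field is $W(|x|)\,x$ with $W(r) = Q(r)/r$, whose divergence is
  $N W + r W' = Q' + (N-1) Q / r$, and this is $b$ by the equation for $Q$. At the origin the field is
  $(b(0)/N)\,x$ up to $o(|x|)$, and the trace of $b(0)/N$ times the identity is $b(0)$.\<close>
lemma radial_field_divergence:
  fixes b :: "real \<Rightarrow> real" and x :: "real ^ 'n"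
  assumes b: "continuous_on {0..} b"
  defines "F \<equiv> \<lambda>x :: real ^ 'n. radial_flux CARD('n) b (norm x) *\<^sub>R sgn x"
  shows "F differentiable (at x)" "divergence F x = b (norm x)"
proof -
  let ?Q = "radial_flux CARD('n) b" and ?n = "real CARD('n)"
  have N: "1 \<le> CARD('n)" by (simp add: Suc_leI)
  have F: "F = (\<lambda>x. (?Q (norm x) / norm x) *\<^sub>R x)"
    by (simp add: F_def fun_eq_iff sgn_div_norm divide_inverse)
  have "\<exists>F'. (F has_derivative F') (at x) \<and> (\<Sum>i\<in>UNIV. F' (axis i 1) $ i) = b (norm x)"
  proof (cases "x = 0")
    case True
    have "((\<lambda>h :: real ^ 'n. ?Q (norm h) / norm h) \<longlongrightarrow> b 0 / ?n) (at 0)"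
      by (rule filterlim_compose[OF radial_flux_quotient_tendsto[OF N b] filterlim_norm_at_right_0])
    then have "((\<lambda>h :: real ^ 'n. ?Q (norm h) / norm h - b 0 / ?n) \<longlongrightarrow> 0) (at 0)"
      by (simp add: LIM_zero)
    from tendsto_rabs[OF this]
    have lim: "((\<lambda>h :: real ^ 'n. \<bar>?Q (norm h) / norm h - b 0 / ?n\<bar>) \<longlongrightarrow> 0) (at 0)"
      by simp
    have "(F has_derivative (\<lambda>h. (b 0 / ?n) *\<^sub>R h)) (at 0)"
      unfolding has_derivative_at
    proof
      show "bounded_linear (\<lambda>h :: real ^ 'n. (b 0 / ?n) *\<^sub>R h)"
        by (rule bounded_linear_scaleR_right)
      have eq: "norm (F h - F 0 - (b 0 / ?n) *\<^sub>R h) / norm h = \<bar>?Q (norm h) / norm h - b 0 / ?n\<bar>"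
        if "h \<noteq> 0" for h
        using that by (simp add: F scaleR_diff_left[symmetric])
      show "(\<lambda>h. norm (F (0 + h) - F 0 - (b 0 / ?n) *\<^sub>R h) / norm h) \<midarrow>0\<rightarrow> 0"
        by (rule Lim_transform_eventually[OF lim]) (simp add: eventually_at_filter eq always_eventually)
    qed
    with True show ?thesis
      by (intro exI[of _ "\<lambda>h. (b 0 / ?n) *\<^sub>R h"]) simp
  next
    case False
    define r where "r = norm x"
    define W where "W = (\<lambda>r. ?Q r / r)"
    define W' where "W' = ((b r - (?n - 1) * ?Q r / r) * r - ?Q r) / (r * r)"
    have r: "0 < r" using False by (simp add: r_def)
    have "(W has_real_derivative W') (at r)"
      unfolding W_def W'_def using DERIV_divide[OF radial_flux_has_derivative[OF N b r] DERIV_ident] r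
      by simp
    then have "GDERIV (\<lambda>x. W (norm x)) x :> W' *\<^sub>R sgn x"
      using False by (intro GDERIV_DERIV_compose GDERIV_norm) (simp_all add: r_def)
    then have "((\<lambda>x. W (norm x) *\<^sub>R x) has_derivative (\<lambda>h. W (norm x) *\<^sub>R h + (h \<bullet> (W' *\<^sub>R sgn x)) *\<^sub>R x)) (at x)"
      unfolding gderiv_def by (intro has_derivative_scaleR has_derivative_ident)
    moreover have "(\<Sum>i\<in>UNIV. (W (norm x) *\<^sub>R axis i 1 + (axis i 1 \<bullet> (W' *\<^sub>R sgn x)) *\<^sub>R x) $ i) = b (norm x)"
    proof -
      have "(\<Sum>i\<in>UNIV. (W (norm x) *\<^sub>R axis i 1 + (axis i 1 \<bullet> (W' *\<^sub>R sgn x)) *\<^sub>R x) $ i)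
          = ?n * W r + W' * (sgn x \<bullet> x)"
        unfolding inner_vec_def[of "sgn x" x]
        by (simp add: inner_axis' sum.distrib r_def sum_distrib_left mult.assoc del: inner_scaleR_right)
      also have "sgn x \<bullet> x = r"
        using r by (simp add: sgn_div_norm r_def power2_norm_eq_inner[symmetric] power2_eq_square)
      also have "?n * W r + W' * r = b r"
        using r by (simp add: W_def W'_def field_simps)
      finally show ?thesis by (simp add: r_def)
    qed
    ultimately show ?thesis
      unfolding F W_def by (intro exI conjI)
  qed
  then obtain F' where "(F has_derivative F') (at x)" "(\<Sum>i\<in>UNIV. F' (axis i 1) $ i) = b (norm x)"
    by blast
  then show "F differentiable (at x)" "divergence F x = b (norm x)"
    using divergence_eq[of F F' x] by (simp_all add: differentiableI)
qed

section \<open>The inverse of h\<close>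

locale admissible =
  fixes \<phi> :: "real \<Rightarrow> real" and kl ku :: real and \<theta>l \<theta>u \<psi>l \<psi>u :: "real \<Rightarrow> real"
  assumes admissible: "admissible_phi \<phi> kl ku \<theta>l \<theta>u \<psi>l \<psi>u"
begin

lemma theta_u: "nonneg_cont_incr \<theta>u"
  and psi_u: "nonneg_cont \<psi>u" and psi_l: "nonneg_cont \<psi>l"
  and k_pos: "0 < kl" "0 < ku"
  and hinv_bounds: "\<And>s1 s2. 0 < s1 \<Longrightarrow> 0 < s2 \<Longrightarrow> kl * \<theta>l s1 * \<psi>l s2 \<le> hinv \<phi> (s1 * s2)"
    "\<And>s1 s2. 0 < s1 \<Longrightarrow> 0 < s2 \<Longrightarrow> hinv \<phi> (s1 * s2) \<le> ku * \<theta>u s1 * \<psi>u s2"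
  using admissible by (auto simp: admissible_phi_def)

lemma h_strict_mono: "strict_mono_on {0<..} (h_of \<phi>)" and h_image: "h_of \<phi> ` {0<..} = {0<..}"
  using admissible by (auto simp: admissible_phi_def)

lemma hinv_0 [simp]: "hinv \<phi> 0 = 0"
  by (simp add: hinv_def)

lemma hinv_pos:
  assumes "0 < s"
  shows "0 < hinv \<phi> s" "h_of \<phi> (hinv \<phi> s) = s"
proof -
  have "s \<in> h_of \<phi> ` {0<..}"
    using assms h_image by simp
  then show "0 < hinv \<phi> s" "h_of \<phi> (hinv \<phi> s) = s"
    using assms inv_into_into[of s "h_of \<phi>" "{0<..}"] f_inv_into_f[of s "h_of \<phi>" "{0<..}"]
    by (auto simp: hinv_def)
qed

lemma hinv_h: "0 < t \<Longrightarrow> hinv \<phi> (h_of \<phi> t) = t"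
  using h_image strict_mono_on_imp_inj_on[OF h_strict_mono] by (force simp: hinv_def)

lemma hinv_nonneg: "0 \<le> s \<Longrightarrow> 0 \<le> hinv \<phi> s"
  using hinv_pos(1)[of s] by (cases "s = 0") auto

lemma hinv_mono:
  assumes "0 \<le> s" "s \<le> t"
  shows "hinv \<phi> s \<le> hinv \<phi> t"
proof (cases "s = 0")
  case False
  show ?thesis
  proof (rule ccontr)
    assume "\<not> ?thesis"
    then have "h_of \<phi> (hinv \<phi> t) < h_of \<phi> (hinv \<phi> s)"
      using False assms hinv_pos(1)[of s] hinv_pos(1)[of t]
      by (intro strict_mono_onD[OF h_strict_mono]) auto
    then show False
      using False assms by (simp add: hinv_pos)
  qed
qed (use assms hinv_nonneg in auto)

text \<open>A monotone function with open range is continuous. Extending the inverse by the identity to the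
  negative half-line makes its range the whole real line, which includes continuity at 0.\<close>
lemma hinv_nonneg_cont_incr: "nonneg_cont_incr (hinv \<phi>)"
proof -
  let ?k = "\<lambda>s. if s \<le> 0 then s else hinv \<phi> s"
  have "t \<in> range ?k" for t
  proof (cases "t \<le> 0")
    case True
    then show ?thesis by (intro range_eqI[of _ _ t]) simp
  next
    case False
    then have "0 < h_of \<phi> t" using h_image by auto
    with False show ?thesis by (intro range_eqI[of _ _ "h_of \<phi> t"]) (simp add: hinv_h)
  qed
  then have "range ?k = UNIV" by auto
  then have "continuous_on UNIV ?k"
    by (intro continuous_onI_mono) (auto intro: hinv_mono dest: hinv_nonneg intro: order_trans[OF _ hinv_nonneg])
  then have "continuous_on {0..} ?k"
    by (rule continuous_on_subset) auto
  then have "continuous_on {0..} (hinv \<phi>)"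
    by (rule continuous_on_eq) auto
  then show ?thesis
    by (auto simp: nonneg_cont_incr_def nonneg_cont_def mono_on_def intro: hinv_mono hinv_nonneg)
qed

lemmas hinv_nonneg_cont = nonneg_cont_incrD(1)[OF hinv_nonneg_cont_incr]

lemma phi_abs_hinv: "0 \<le> s \<Longrightarrow> \<phi> \<bar>hinv \<phi> s\<bar> * hinv \<phi> s = s"
  using hinv_pos[of s] by (cases "s = 0") (auto simp: h_of_def mult.commute)

lemma hinv_upper: "0 < s1 \<Longrightarrow> 0 \<le> s2 \<Longrightarrow> hinv \<phi> (s1 * s2) \<le> ku * \<theta>u s1 * \<psi>u s2"
  using hinv_bounds(2)[of s1 s2] k_pos nonneg_cont_incrD(3)[OF theta_u, of s1] psi_u
  by (cases "s2 = 0") (auto simp: nonneg_cont_def)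

text \<open>The hypothesis concerns positive products only. The case of a vanishing second factor follows by letting
  that factor tend to 0, as both sides are continuous there.\<close>
lemma hinv_lower:
  assumes "0 < s1" "0 \<le> s2"
  shows "kl * \<theta>l s1 * \<psi>l s2 \<le> hinv \<phi> (s1 * s2)"
proof (cases "s2 = 0")
  case True
  have lim: "(f \<longlongrightarrow> f 0) (at_right 0)" if "nonneg_cont f" for f :: "real \<Rightarrow> real"
    using nonneg_contD(1)[OF that] by (simp add: continuous_on_def at_within_Ici_at_right[symmetric])
  have "((\<lambda>s. hinv \<phi> (s1 * s)) \<longlongrightarrow> hinv \<phi> (s1 * 0)) (at_right 0)"
    by (intro lim nonneg_cont_compose[OF hinv_nonneg_cont])
       (use assms(1) in \<open>simp add: nonneg_cont_def continuous_on_mult_left\<close>)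
  moreover have "((\<lambda>s. kl * \<theta>l s1 * \<psi>l s) \<longlongrightarrow> kl * \<theta>l s1 * \<psi>l 0) (at_right 0)"
    by (intro tendsto_mult_left lim psi_l)
  moreover have "\<forall>\<^sub>F s in at_right 0. kl * \<theta>l s1 * \<psi>l s \<le> hinv \<phi> (s1 * s)"
    using assms(1) by (intro eventually_at_rightI[of 0 1]) (auto intro: hinv_bounds(1))
  ultimately show ?thesis
    using True by (auto intro: tendsto_le[OF trivial_limit_at_right_real])
qed (use assms hinv_bounds in auto)

lemma theta_u_pos: "0 < s \<Longrightarrow> 0 < \<theta>u s"
  using hinv_bounds(2)[of s 1] hinv_pos(1)[of s] nonneg_cont_incrD(3)[OF theta_u, of s]
  by (cases "\<theta>u s = 0") auto

end

section \<open>The integral operator of one equation\<close>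

text \<open>The profile with central value \<open>c\<close> that solves the radial equation whose right-hand side is
  $a(r) f(x(r))$ for a given function \<open>x\<close>.\<close>
definition radial_op ::
  "nat \<Rightarrow> (real \<Rightarrow> real) \<Rightarrow> (real \<Rightarrow> real) \<Rightarrow> (real \<Rightarrow> real) \<Rightarrow> real \<Rightarrow> (real \<Rightarrow> real) \<Rightarrow> real \<Rightarrow> real" where
  "radial_op N \<phi> a f c x r = c + integral {0..r} (\<lambda>t. hinv \<phi> (radial_flux N (\<lambda>s. a s * f (x s)) t))"

lemma A_fun_eq: "A_fun N k \<psi> a t = integral {0..t} (\<lambda>s. k * \<psi> (radial_flux N a s))"
  by (simp add: A_fun_def radial_flux_def)

lemma P_fun_eq:
  "P_fun N w c a \<xi> A r = integral {0..r} (\<lambda>y. w (c * radial_flux N (\<lambda>t. a t * \<xi> (1 + A t)) y))"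
  by (simp add: P_fun_def radial_flux_def mult.assoc)

lemma radial_op_cong:
  assumes "\<And>s. 0 \<le> s \<Longrightarrow> x s = y s"
  shows "radial_op N \<phi> a f c x = radial_op N \<phi> a f c y"
proof -
  have "radial_flux N (\<lambda>s. a s * f (x s)) t = radial_flux N (\<lambda>s. a s * f (y s)) t" for t
    unfolding radial_flux_def using assms by (intro arg_cong2[where f = "(*)"] integral_cong refl) simp
  then show ?thesis
    by (simp add: fun_eq_iff radial_op_def)
qed

lemma nonneg_cont_A_fun:
  assumes "1 \<le> N" "0 \<le> k" "nonneg_cont \<psi>" "nonneg_cont a"
  shows "nonneg_cont (A_fun N k \<psi> a)"
  unfolding A_fun_eq[abs_def]
  by (intro nonneg_cont_integral nonneg_cont_const_mult assms nonneg_cont_compose[OF assms(3)] nonneg_cont_radial_flux)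

locale radial_equation = admissible \<phi> kl ku \<theta>l \<theta>u \<psi>l \<psi>u
  for \<phi> kl ku \<theta>l \<theta>u \<psi>l \<psi>u +
  fixes N :: nat and a f :: "real \<Rightarrow> real" and c :: real
  assumes N_pos: "1 \<le> N" and a: "nonneg_cont a" and f: "nonneg_cont_incr f"
    and f_pos: "\<And>s. 0 < s \<Longrightarrow> 0 < f s" and c_pos: "0 < c"
begin

abbreviation "op \<equiv> radial_op N \<phi> a f c"
abbreviation "slope x t \<equiv> hinv \<phi> (radial_flux N (\<lambda>s. a s * f (x s)) t)"

lemma source_nonneg_cont: "nonneg_cont x \<Longrightarrow> nonneg_cont (\<lambda>s. a s * f (x s))"
  by (intro nonneg_cont_mult a nonneg_cont_compose[of f x] nonneg_cont_incrD(1)[OF f])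

lemma source_continuous: "nonneg_cont x \<Longrightarrow> continuous_on {0..} (\<lambda>s. a s * f (x s))"
  using source_nonneg_cont by (simp add: nonneg_cont_def)

lemma flux_nonneg_cont: "nonneg_cont x \<Longrightarrow> nonneg_cont (radial_flux N (\<lambda>s. a s * f (x s)))"
  by (intro nonneg_cont_radial_flux N_pos source_nonneg_cont)

lemma slope_nonneg_cont: "nonneg_cont x \<Longrightarrow> nonneg_cont (slope x)"
  by (intro nonneg_cont_compose[OF hinv_nonneg_cont] flux_nonneg_cont)

lemma op_has_derivative:
  assumes "nonneg_cont x" "0 \<le> r"
  shows "(op x has_real_derivative slope x r) (at r within {0..})"
proof -
  have "op x = (\<lambda>r. c + integral {0..r} (slope x))"
    by (simp add: fun_eq_iff radial_op_def)
  moreover have "continuous_on {0..} (slope x)"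
    using slope_nonneg_cont[OF assms(1)] by (simp add: nonneg_cont_def)
  ultimately show ?thesis
    using integral_has_real_derivative_atLeast[of 0 "slope x" r] assms(2)
    by (auto intro!: derivative_eq_intros)
qed

lemma op_nonneg_cont: "nonneg_cont x \<Longrightarrow> nonneg_cont (op x)"
  using nonneg_cont_const_add[OF less_imp_le[OF c_pos] nonneg_cont_integral[OF slope_nonneg_cont]]
  by (simp add: radial_op_def[abs_def])

lemma op_incr: "nonneg_cont x \<Longrightarrow> r \<le> s \<Longrightarrow> op x r \<le> op x s"
  using integral_mono_upper_limit[OF slope_nonneg_cont] by (simp add: radial_op_def)

lemma op_0 [simp]: "op x 0 = c"
  by (simp add: radial_op_def)

lemma op_ge: "nonneg_cont x \<Longrightarrow> 0 \<le> r \<Longrightarrow> c \<le> op x r"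
  using op_incr[of x 0 r] by simp

text \<open>Each step in the definition of the operator, namely \<open>f\<close>, the flux, the inverse of \<open>h\<close> and the integral,
  preserves order.\<close>
lemma op_mono:
  assumes x: "nonneg_cont x" and y: "nonneg_cont y" and "0 \<le> r"
    and le: "\<And>s. 0 \<le> s \<Longrightarrow> s \<le> r \<Longrightarrow> x s \<le> y s"
  shows "op x r \<le> op y r"
proof -
  have "slope x t \<le> slope y t" if t: "t \<in> {0..r}" for t
  proof (rule hinv_mono)
    show "0 \<le> radial_flux N (\<lambda>s. a s * f (x s)) t"
      using flux_nonneg_cont[OF x] t by (simp add: nonneg_cont_def)
    have "a s * f (x s) \<le> a s * f (y s)" if "0 \<le> s" "s \<le> t" for s
      using that t a le[of s] x
      by (intro mult_left_mono nonneg_cont_incrD(2)[OF f]) (auto simp: nonneg_contD)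
    then show "radial_flux N (\<lambda>s. a s * f (x s)) t \<le> radial_flux N (\<lambda>s. a s * f (y s)) t"
      using t x y by (intro radial_flux_mono source_continuous) auto
  qed
  then show ?thesis
    unfolding radial_op_def
    by (intro add_left_mono integral_le continuous_on_atLeast_integrable
        nonneg_contD(1)[OF slope_nonneg_cont] x y)
qed

text \<open>For nondecreasing \<open>x\<close> the factor $f(x(s))$ with $s \le r$ is at most $f(x(r))$ and leaves the inner integral;
  the upper bound for the inverse of \<open>h\<close> then splits it from the part that depends on \<open>a\<close> alone.\<close>
lemma op_le_A_fun:
  assumes x: "nonneg_cont x" "\<And>s t. 0 \<le> s \<Longrightarrow> s \<le> t \<Longrightarrow> x s \<le> x t" "0 < x r" and "0 \<le> r"
  shows "op x r \<le> c + \<theta>u (f (x r)) * A_fun N ku \<psi>u a r"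
proof -
  have "slope x t \<le> \<theta>u (f (x r)) * (ku * \<psi>u (radial_flux N a t))" if t: "t \<in> {0..r}" for t
  proof -
    have "a s * f (x s) \<le> f (x r) * a s" if "0 \<le> s" "s \<le> t" for s
      using that t nonneg_contD(2)[OF a, of s] nonneg_contD(2)[OF x(1), of s] x(2)[of s r]
        nonneg_cont_incrD(2)[OF f, of "x s" "x r"]
      by (subst mult.commute, intro mult_right_mono) auto
    then have "radial_flux N (\<lambda>s. a s * f (x s)) t \<le> radial_flux N (\<lambda>s. f (x r) * a s) t"
      using t x a by (intro radial_flux_mono source_continuous) (simp_all add: nonneg_contD continuous_on_mult_left)
    then have "slope x t \<le> hinv \<phi> (f (x r) * radial_flux N a t)"
      using flux_nonneg_cont[OF x(1)] t
      by (intro hinv_mono) (auto simp: nonneg_contD radial_flux_cmult)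
    also have "\<dots> \<le> ku * \<theta>u (f (x r)) * \<psi>u (radial_flux N a t)"
      using t nonneg_cont_radial_flux[OF N_pos a] x(3)
      by (intro hinv_upper f_pos) (auto simp: nonneg_contD)
    finally show ?thesis by (simp add: ac_simps)
  qed
  then have "integral {0..r} (slope x)
      \<le> integral {0..r} (\<lambda>t. \<theta>u (f (x r)) * (ku * \<psi>u (radial_flux N a t)))"
    using slope_nonneg_cont[OF x(1)] nonneg_cont_compose[OF psi_u nonneg_cont_radial_flux[OF N_pos a]]
    by (intro integral_le continuous_on_atLeast_integrable)
       (simp_all add: nonneg_contD continuous_on_mult_left)
  then show ?thesis
    unfolding radial_op_def A_fun_eq by simp
qed

text \<open>The same splitting from below, with the constant $f(l)$ in place of $f(x(r))$.\<close>
lemma op_ge_A_fun: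
  assumes x: "nonneg_cont x" "0 < l" "\<And>s. 0 \<le> s \<Longrightarrow> l \<le> x s" and "0 \<le> r"
  shows "c + \<theta>l (f l) * A_fun N kl \<psi>l a r \<le> op x r"
proof -
  have "\<theta>l (f l) * (kl * \<psi>l (radial_flux N a t)) \<le> slope x t" if t: "t \<in> {0..r}" for t
  proof -
    have flux: "0 \<le> radial_flux N a t"
      using t nonneg_cont_radial_flux[OF N_pos a] by (auto simp: nonneg_cont_def)
    have "f l * a s \<le> a s * f (x s)" if "0 \<le> s" for s
      using that nonneg_contD(2)[OF a, of s] x(2,3) nonneg_cont_incrD(2)[OF f, of l "x s"]
      by (subst mult.commute, intro mult_left_mono) auto
    then have "radial_flux N (\<lambda>s. f l * a s) t \<le> radial_flux N (\<lambda>s. a s * f (x s)) t"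
      using t x a by (intro radial_flux_mono source_continuous) (simp_all add: nonneg_contD continuous_on_mult_left)
    then have "hinv \<phi> (f l * radial_flux N a t) \<le> slope x t"
      using flux f_pos[OF x(2)] by (intro hinv_mono) (auto simp: radial_flux_cmult)
    moreover have "kl * \<theta>l (f l) * \<psi>l (radial_flux N a t) \<le> hinv \<phi> (f l * radial_flux N a t)"
      using flux f_pos[OF x(2)] by (intro hinv_lower)
    ultimately show ?thesis by (simp add: ac_simps)
  qed
  then have "integral {0..r} (\<lambda>t. \<theta>l (f l) * (kl * \<psi>l (radial_flux N a t))) \<le> integral {0..r} (slope x)"
    using slope_nonneg_cont[OF x(1)] nonneg_cont_compose[OF psi_l nonneg_cont_radial_flux[OF N_pos a]]
    by (intro integral_le continuous_on_atLeast_integrable)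
       (simp_all add: nonneg_contD continuous_on_mult_left)
  then show ?thesis
    unfolding radial_op_def A_fun_eq by simp
qed

text \<open>Dominated convergence in the inner and then in the outer integral, with majorants built from the local bound
  of the sequence. The limit \<open>y\<close> is merely a pointwise limit; continuity of its image under the
  operator comes from being an indefinite integral of an integrable function.\<close>
lemma radial_op_tendsto:
  assumes x: "\<And>n. nonneg_cont (x n)" and lim: "\<And>r. 0 \<le> r \<Longrightarrow> (\<lambda>n. x n r) \<longlonglongrightarrow> y r"
    and bound: "\<And>r. \<exists>B. \<forall>n. \<forall>s\<in>{0..r}. x n s \<le> B"
  shows "\<And>r. 0 \<le> r \<Longrightarrow> (\<lambda>n. op (x n) r) \<longlonglongrightarrow> op y r" "nonneg_cont (op y)"
proof -
  have x0: "0 \<le> x n r" if "0 \<le> r" for n r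
    using x that by (simp add: nonneg_cont_def)
  have y0: "0 \<le> y r" if "0 \<le> r" for r
    using LIMSEQ_le_const[OF lim[OF that]] x0[OF that] by blast
  have fc: "continuous_on {0..} f" and ac: "continuous_on {0..} a" and a0: "\<And>s. 0 \<le> s \<Longrightarrow> 0 \<le> a s"
    using a nonneg_cont_incrD(1)[OF f] by (auto simp: nonneg_cont_def)
  have source_lim: "(\<lambda>n. s ^ (N - 1) * (a s * f (x n s))) \<longlonglongrightarrow> s ^ (N - 1) * (a s * f (y s))" if "0 \<le> s" for s
    using that x0 y0
    by (intro tendsto_mult_left continuous_on_tendsto_compose[OF fc lim]) auto
  have flux_lim: "(\<lambda>n. radial_flux N (\<lambda>s. a s * f (x n s)) t) \<longlonglongrightarrow> radial_flux N (\<lambda>s. a s * f (y s)) t"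
    if t: "0 \<le> t" for t
  proof -
    obtain B where B: "\<And>n s. s \<in> {0..t} \<Longrightarrow> x n s \<le> B" using bound[of t] by blast
    have "(\<lambda>n. integral {0..t} (\<lambda>s. s ^ (N - 1) * (a s * f (x n s))))
        \<longlonglongrightarrow> integral {0..t} (\<lambda>s. s ^ (N - 1) * (a s * f (y s)))"
    proof (rule dominated_convergence(2)[where h = "\<lambda>s. s ^ (N - 1) * (a s * f B)"])
      show "(\<lambda>s. s ^ (N - 1) * (a s * f (x n s))) integrable_on {0..t}" for n
        by (intro continuous_on_atLeast_integrable continuous_on_weighted source_continuous x)
      show "(\<lambda>s. s ^ (N - 1) * (a s * f B)) integrable_on {0..t}"
        by (intro continuous_on_atLeast_integrable continuous_on_weighted continuous_on_mult ac continuous_on_const)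
      show "norm (s ^ (N - 1) * (a s * f (x n s))) \<le> s ^ (N - 1) * (a s * f B)" if "s \<in> {0..t}" for n s
        using that a0 x0 B nonneg_cont_incrD(2,3)[OF f]
        by (auto simp: abs_mult intro!: mult_left_mono)
    qed (use source_lim in auto)
    then show ?thesis
      unfolding radial_flux_def by (rule tendsto_mult_left)
  qed
  have flux0: "0 \<le> radial_flux N (\<lambda>s. a s * f (x n s)) t" if "0 \<le> t" for n t
    using flux_nonneg_cont[OF x] that by (simp add: nonneg_cont_def)
  have flux0': "0 \<le> radial_flux N (\<lambda>s. a s * f (y s)) t" if "0 \<le> t" for t
    using LIMSEQ_le_const[OF flux_lim[OF that]] flux0[OF that] by blast
  have slope_lim: "(\<lambda>n. slope (x n) t) \<longlonglongrightarrow> slope y t" if "0 \<le> t" for t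
    using hinv_nonneg_cont that flux0 flux0'
    by (intro continuous_on_tendsto_compose[of "{0..}" "hinv \<phi>"] flux_lim) (auto simp: nonneg_contD)
  have main: "slope y integrable_on {0..r} \<and> (\<lambda>n. integral {0..r} (slope (x n))) \<longlonglongrightarrow> integral {0..r} (slope y)" for r
  proof -
    obtain B where B: "\<And>n s. s \<in> {0..r} \<Longrightarrow> x n s \<le> B" using bound[of r] by blast
    have "slope (x n) t \<le> slope (\<lambda>_. max 0 B) t" if t: "t \<in> {0..r}" for n t
    proof (intro hinv_mono radial_flux_mono source_continuous x nonneg_cont_const flux0)
      show "a s * f (x n s) \<le> a s * f (max 0 B)" if "0 \<le> s" "s \<le> t" for s
        using that t a0 x0[of s n] B[of s n] by (intro mult_left_mono nonneg_cont_incrD(2)[OF f]) auto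
    qed (use t in auto)
    moreover have "0 \<le> slope (x n) t" if "0 \<le> t" for n t
      using that by (intro hinv_nonneg flux0)
    moreover have "slope z integrable_on {0..r}" if "nonneg_cont z" for z
      by (intro continuous_on_atLeast_integrable nonneg_contD(1)[OF slope_nonneg_cont] that)
    ultimately show ?thesis
      using dominated_convergence[of "\<lambda>n. slope (x n)" "{0..r}" "slope (\<lambda>_. max 0 B)" "slope y"]
        x slope_lim nonneg_cont_const[of "max 0 B"] by auto
  qed
  show "(\<lambda>n. op (x n) r) \<longlonglongrightarrow> op y r" for r
    unfolding radial_op_def using main by (intro tendsto_add_const_iff[THEN iffD2]) simp
  have "continuous_on {0..r} (op y)" for r
    unfolding radial_op_def[abs_def] using main
    by (intro continuous_on_add continuous_on_const indefinite_integral_continuous_1) auto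
  then have "continuous (at r within {0..}) (op y)" if "0 \<le> r" for r
    using that at_within_atLeast[of r 0]
    by (metis atLeastAtMost_iff continuous_on_eq_continuous_within less_eq_real_def le_add_same_cancel1 zero_le_one)
  moreover have "0 \<le> op y r" if "0 \<le> r" for r
    using LIMSEQ_le_const[OF \<open>(\<lambda>n. op (x n) r) \<longlonglongrightarrow> op y r\<close>, of 0] op_nonneg_cont[OF x] that
    by (auto simp: nonneg_cont_def)
  ultimately show "nonneg_cont (op y)"
    by (simp add: nonneg_cont_def continuous_on_eq_continuous_within)
qed

text \<open>Since $\phi(|t|)\,t = s$ for $t = h^{-1}(s)$, the quantity $r^{N-1}\phi(|u'|)u'$ is exactly the integral that
  defines the flux.\<close>
lemma op_solves_radial:
  assumes x: "nonneg_cont x"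
  shows "continuous_on {0..} (slope x)" "slope x 0 = 0"
    "0 \<le> r \<Longrightarrow> (op x has_real_derivative slope x r) (at r within {0..})"
    "0 \<le> r \<Longrightarrow> ((\<lambda>s. s ^ (N - 1) * \<phi> \<bar>slope x s\<bar> * slope x s) has_real_derivative
       r ^ (N - 1) * a r * f (x r)) (at r within {0..})"
proof -
  show "((\<lambda>s. s ^ (N - 1) * \<phi> \<bar>slope x s\<bar> * slope x s) has_real_derivative
       r ^ (N - 1) * a r * f (x r)) (at r within {0..})" if "0 \<le> r"
  proof (rule has_field_derivative_transform_within[OF _ zero_less_one])
    show "((\<lambda>s. s ^ (N - 1) * radial_flux N (\<lambda>s. a s * f (x s)) s) has_real_derivative
       r ^ (N - 1) * a r * f (x r)) (at r within {0..})"
      using weighted_integral_has_derivative[OF N_pos source_continuous[OF x] that] by (simp add: mult.assoc)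
    show "s ^ (N - 1) * radial_flux N (\<lambda>s. a s * f (x s)) s = s ^ (N - 1) * \<phi> \<bar>slope x s\<bar> * slope x s"
      if "s \<in> {0..}" for s
      using phi_abs_hinv[OF nonneg_contD(2)[OF flux_nonneg_cont[OF x]], of s] that
      by (simp add: mult.assoc)
  qed (use that in simp)
qed (use op_has_derivative slope_nonneg_cont x in \<open>auto simp: nonneg_contD\<close>)

text \<open>The gradient of the radial extension is $h^{-1}(Q(|z|))\,z/|z|$, so its flux is the radial field
  $Q(|z|)\,z/|z|$.\<close>
lemma op_solves_PDE:
  fixes z :: "real ^ 'n"
  assumes x: "nonneg_cont x" and N: "CARD('n) = N"
  defines "U \<equiv> \<lambda>z :: real ^ 'n. op x (norm z)"
  shows "U differentiable (at z)" "phi_flux \<phi> U differentiable (at z)"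
    "phi_Laplacian \<phi> U z = a (norm z) * f (x (norm z))"
proof -
  have U: "GDERIV U z :> slope x (norm z) *\<^sub>R sgn z" for z
    unfolding U_def by (rule GDERIV_radial) (use op_has_derivative[OF x] in auto)
  then show "U differentiable (at z)"
    unfolding gderiv_def by (rule differentiableI)
  have "phi_flux \<phi> U z = radial_flux N (\<lambda>s. a s * f (x s)) (norm z) *\<^sub>R sgn z" for z
  proof (cases "z = 0")
    case False
    then show ?thesis
      using phi_abs_hinv[OF nonneg_contD(2)[OF flux_nonneg_cont[OF x]], of "norm z"]
      by (simp add: phi_flux_def grad_eq[OF U] norm_sgn)
  qed (simp add: phi_flux_def grad_eq[OF U])
  then have flux: "phi_flux \<phi> U = (\<lambda>z. radial_flux N (\<lambda>s. a s * f (x s)) (norm z) *\<^sub>R sgn z)"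
    by (rule ext)
  show "phi_flux \<phi> U differentiable (at z)" "phi_Laplacian \<phi> U z = a (norm z) * f (x (norm z))"
    using radial_field_divergence[OF source_continuous[OF x], where x = z]
    unfolding phi_Laplacian_def flux N by simp_all
qed

end

section \<open>Coupling two equations\<close>

locale radial_pair =
  eq1: radial_equation \<phi>1 kl1 ku1 \<theta>l1 \<theta>u1 \<psi>l1 \<psi>u1 N a1 f1 \<alpha> +
  eq2: radial_equation \<phi>2 kl2 ku2 \<theta>l2 \<theta>u2 \<psi>l2 \<psi>u2 N a2 f2 \<beta>
  for N \<phi>1 kl1 ku1 \<theta>l1 \<theta>u1 \<psi>l1 \<psi>u1 a1 f1 \<alpha> \<phi>2 kl2 ku2 \<theta>l2 \<theta>u2 \<psi>l2 \<psi>u2 a2 f2 \<beta>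
begin

text \<open>As $v \ge \beta$, the first component is at least $\alpha + \underline\theta_1(f_1(\beta))\,\underline A$. Since \<open>m\<close> is below
  \<open>\<alpha>\<close> and below the coefficient of $\underline A$, this is at least $m\,(1 + \underline A)$, to which the lower bound on $f_2$ applies; \<open>v\<close> then
  dominates the divergent integral.\<close>
lemma second_component_at_top:
  assumes u: "nonneg_cont u" and v: "nonneg_cont v" and uv: "u = eq1.op v" "v = eq2.op u"
    and cl: "0 < cl" and xi: "nonneg_cont \<xi>" and m: "0 < m" "m < min \<alpha> (\<theta>l1 (f1 \<beta>))"
    and lower: "\<And>w. 1 \<le> w \<Longrightarrow> cl * \<xi> w \<le> f2 (m * w)"
    and P: "filterlim (P_fun N (hinv \<phi>2) cl a2 \<xi> (A_fun N kl1 \<psi>l1 a1)) at_top at_top"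
  shows "filterlim v at_top at_top"
proof (rule filterlim_at_top_mono[OF P])
  let ?A = "A_fun N kl1 \<psi>l1 a1"
  have A: "nonneg_cont ?A"
    using eq1.k_pos by (intro nonneg_cont_A_fun eq1.N_pos eq1.psi_l eq1.a) auto
  have b: "nonneg_cont (\<lambda>s. a2 s * \<xi> (1 + ?A s))"
    by (intro nonneg_cont_mult eq2.a nonneg_cont_compose[OF xi] nonneg_cont_const_add A) simp
  have source_le: "cl * (a2 s * \<xi> (1 + ?A s)) \<le> a2 s * f2 (u s)" if s: "0 \<le> s" for s
  proof -
    have A0: "0 \<le> ?A s" by (rule nonneg_contD(2)[OF A s])
    have "\<beta> \<le> v s" if "0 \<le> s" for s
      using eq2.op_ge[OF u that] uv(2) by simp
    then have "\<alpha> + \<theta>l1 (f1 \<beta>) * ?A s \<le> u s"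
      using eq1.op_ge_A_fun[OF v eq2.c_pos _ s] uv(1) by simp
    moreover have "m * ?A s \<le> \<theta>l1 (f1 \<beta>) * ?A s"
      using m A0 by (intro mult_right_mono) auto
    ultimately have "m * (1 + ?A s) \<le> u s"
      using m by (simp add: distrib_left)
    then have "f2 (m * (1 + ?A s)) \<le> f2 (u s)"
      using m A0 by (intro nonneg_cont_incrD(2)[OF eq2.f]) auto
    then have "cl * \<xi> (1 + ?A s) \<le> f2 (u s)"
      using lower[of "1 + ?A s"] A0 by simp
    from mult_left_mono[OF this nonneg_contD(2)[OF eq2.a s]] show ?thesis
      by (simp add: ac_simps)
  qed
  have flux_le: "cl * radial_flux N (\<lambda>s. a2 s * \<xi> (1 + ?A s)) t \<le> radial_flux N (\<lambda>s. a2 s * f2 (u s)) t"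
    if "0 \<le> t" for t
    unfolding radial_flux_cmult[symmetric]
    by (intro radial_flux_mono that nonneg_contD(1)[OF nonneg_cont_const_mult[OF less_imp_le[OF cl] b]]
        eq2.source_continuous[OF u] source_le)
  have "P_fun N (hinv \<phi>2) cl a2 \<xi> ?A r \<le> v r" if r: "0 \<le> r" for r
  proof -
    have "nonneg_cont (\<lambda>t. hinv \<phi>2 (cl * radial_flux N (\<lambda>s. a2 s * \<xi> (1 + ?A s)) t))"
      using cl by (intro nonneg_cont_compose[OF eq2.hinv_nonneg_cont] nonneg_cont_const_mult
          nonneg_cont_radial_flux eq2.N_pos b) simp
    then have "P_fun N (hinv \<phi>2) cl a2 \<xi> ?A r \<le> integral {0..r} (eq2.slope u)"
      unfolding P_fun_eq using cl nonneg_contD(2)[OF nonneg_cont_radial_flux[OF eq2.N_pos b]]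
      by (intro integral_le continuous_on_atLeast_integrable nonneg_contD(1)
          eq2.slope_nonneg_cont[OF u] eq2.hinv_mono flux_le) auto
    moreover have "v r = \<beta> + integral {0..r} (eq2.slope u)"
      by (subst uv(2)) (simp add: radial_op_def)
    ultimately show ?thesis
      using eq2.c_pos by simp
  qed
  then show "\<forall>\<^sub>F r in at_top. P_fun N (hinv \<phi>2) cl a2 \<xi> ?A r \<le> v r"
    using eventually_ge_at_top[of "0::real"] by (rule eventually_mono[rotated])
qed

end

text \<open>The growth hypotheses are imposed on the first equation only. The locale thus bounds the first component
  in terms of data of the second, and interpreting it once more with the equations exchanged treats the
  other component.\<close>
locale dominated_pair =
  radial_pair N \<phi>1 kl1 ku1 \<theta>l1 \<theta>u1 \<psi>l1 \<psi>u1 a1 f1 \<alpha> \<phi>2 kl2 ku2 \<theta>l2 \<theta>u2 \<psi>l2 \<psi>u2 a2 f2 \<beta>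
  for N \<phi>1 kl1 ku1 \<theta>l1 \<theta>u1 \<psi>l1 \<psi>u1 a1 f1 \<alpha> \<phi>2 kl2 ku2 \<theta>l2 \<theta>u2 \<psi>l2 \<psi>u2 a2 f2 \<beta> +
  fixes M cu :: real and g \<xi> :: "real \<Rightarrow> real"
  assumes M: "max 1 (\<beta> / \<theta>u2 (f2 \<alpha>)) \<le> M" and cu: "0 < cu"
    and g: "nonneg_cont_incr g" and xi: "nonneg_cont \<xi>"
    and f1_upper: "\<And>t w. 1 \<le> w \<Longrightarrow> M * \<theta>u2 (f2 \<alpha>) \<le> t \<Longrightarrow> f1 (t * w) \<le> cu * g t * \<xi> w"
    and H_at_top: "filterlim (H_fun \<alpha> \<theta>u1 g M \<theta>u2 f2) at_top at_top"
begin

text \<open>Up to the factor $1 + A$, the second component is bounded by the barrier at the value of the first; \<open>growth\<close>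
  is the resulting nonlinearity in the differential inequality for the first component.\<close>
abbreviation "barrier x \<equiv> M * \<theta>u2 (f2 x)"
abbreviation "growth x \<equiv> \<theta>u1 (g (barrier x))"
abbreviation "H \<equiv> H_fun \<alpha> \<theta>u1 g M \<theta>u2 f2"
abbreviation "A \<equiv> A_fun N ku2 \<psi>u2 a2"
abbreviation "P \<equiv> P_fun N \<psi>u1 cu a1 \<xi> A"

lemma M_ge_1: "1 \<le> M"
  using M by simp

lemma barrier_nonneg_cont: "nonneg_cont barrier"
  using M_ge_1
  by (intro nonneg_cont_const_mult nonneg_cont_compose[OF nonneg_cont_incrD(1)[OF eq2.theta_u]]
      nonneg_cont_incrD(1)[OF eq2.f]) simp

lemma barrier_mono: "0 \<le> x \<Longrightarrow> x \<le> y \<Longrightarrow> barrier x \<le> barrier y"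
  using M_ge_1
  by (intro mult_left_mono nonneg_cont_incrD(2)[OF eq2.theta_u] nonneg_cont_incrD(2,3)[OF eq2.f]) auto

lemma theta_u2_mono: "0 \<le> x \<Longrightarrow> x \<le> y \<Longrightarrow> \<theta>u2 (f2 x) \<le> \<theta>u2 (f2 y)"
  by (intro nonneg_cont_incrD(2)[OF eq2.theta_u] nonneg_cont_incrD(2,3)[OF eq2.f])

lemma barrier_pos: "0 < x \<Longrightarrow> 0 < barrier x"
  using M_ge_1 eq2.theta_u_pos[OF eq2.f_pos] by simp

text \<open>The upper bound on $f_1$ with $w = 1$ forces $g$ to be positive at the barrier values, because $f_1$ is.\<close>
lemma g_barrier_pos:
  assumes "\<alpha> \<le> x"
  shows "0 < g (barrier x)"
proof -
  have x: "0 < x" using assms eq1.c_pos by simp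
  have "0 < f1 (barrier x)"
    by (intro eq1.f_pos barrier_pos x)
  also have "\<dots> \<le> cu * g (barrier x) * \<xi> 1"
    using f1_upper[of 1 "barrier x"] barrier_mono[of \<alpha> x] assms eq1.c_pos by simp
  finally have "g (barrier x) \<noteq> 0" by auto
  then show ?thesis
    using nonneg_cont_incrD(3)[OF g less_imp_le[OF barrier_pos[OF x]]] by simp
qed

lemma growth_pos: "\<alpha> \<le> x \<Longrightarrow> 0 < growth x"
  by (intro eq1.theta_u_pos g_barrier_pos)

lemma H_has_derivative:
  assumes "\<alpha> \<le> x"
  shows "(H has_real_derivative 1 / growth x) (at x within {\<alpha>..})"
proof -
  have "nonneg_cont growth"
    by (intro nonneg_cont_compose[OF nonneg_cont_incrD(1)[OF eq1.theta_u]]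
        nonneg_cont_compose[OF nonneg_cont_incrD(1)[OF g]] barrier_nonneg_cont)
  then have "continuous_on {\<alpha>..} growth"
    using eq1.c_pos by (intro continuous_on_subset[OF nonneg_contD(1)]) auto
  then have "continuous_on {\<alpha>..} (\<lambda>x. 1 / growth x)"
    using growth_pos by (intro continuous_on_divide continuous_on_const) force+
  from integral_has_real_derivative_atLeast[OF this assms] show ?thesis
    unfolding H_fun_def .
qed

lemma A_nonneg_cont: "nonneg_cont A"
  using eq2.k_pos by (intro nonneg_cont_A_fun eq2.N_pos eq2.psi_u eq2.a) auto

lemma P_integrand_nonneg_cont:
  "nonneg_cont (\<lambda>t. \<psi>u1 (cu * radial_flux N (\<lambda>s. a1 s * \<xi> (1 + A s)) t))"
  using cu by (intro nonneg_cont_compose[OF eq1.psi_u] nonneg_cont_const_mult nonneg_cont_radial_flux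
      eq1.N_pos nonneg_cont_mult eq1.a nonneg_cont_compose[OF xi] nonneg_cont_const_add A_nonneg_cont) auto

text \<open>The differential inequality for $u = T_1 v$. The condition $v \le T_2 T_1 v$ is what allows \<open>v\<close> to be estimated
  by \<open>u\<close>; it holds with equality for a solution, and for $v = T_2 u_n$ because the iterates $u_n$
  increase.\<close>
lemma slope_le_growth:
  assumes v: "nonneg_cont v" and sub: "\<And>s. 0 \<le> s \<Longrightarrow> v s \<le> eq2.op (eq1.op v) s" and t: "0 \<le> t"
  shows "eq1.slope v t \<le> ku1 * growth (eq1.op v t) * \<psi>u1 (cu * radial_flux N (\<lambda>s. a1 s * \<xi> (1 + A s)) t)"
proof -
  define u where "u = eq1.op v"
  have u: "nonneg_cont u" "\<And>r s. r \<le> s \<Longrightarrow> u r \<le> u s" "\<And>s. 0 \<le> s \<Longrightarrow> \<alpha> \<le> u s"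
    using eq1.op_nonneg_cont[OF v] eq1.op_incr[OF v] eq1.op_ge[OF v] by (auto simp: u_def)
  let ?G = "g (barrier (u t))" and ?b = "\<lambda>s. a1 s * \<xi> (1 + A s)"
  have b: "nonneg_cont ?b"
    by (intro nonneg_cont_mult eq1.a nonneg_cont_compose[OF xi] nonneg_cont_const_add A_nonneg_cont) simp
  have G: "0 < ?G"
    by (intro g_barrier_pos u t)
  have "a1 s * f1 (v s) \<le> ?G * cu * ?b s" if s: "0 \<le> s" "s \<le> t" for s
  proof -
    have us: "\<alpha> \<le> u s" "0 < u s"
      using u(3)[OF s(1)] eq1.c_pos by auto
    have A0: "0 \<le> A s" by (rule nonneg_contD(2)[OF A_nonneg_cont s(1)])
    \<comment> \<open>Positivity at \<open>\<alpha>\<close> makes the quotient in the choice of \<open>M\<close> a genuine bound for \<open>\<beta>\<close>.\<close>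
    have theta: "0 < \<theta>u2 (f2 \<alpha>)" "\<theta>u2 (f2 \<alpha>) \<le> \<theta>u2 (f2 (u s))"
      using eq1.c_pos us by (auto intro: eq2.theta_u_pos eq2.f_pos theta_u2_mono)
    have "v s \<le> \<beta> + \<theta>u2 (f2 (u s)) * A s"
      using sub[OF s(1)] eq2.op_le_A_fun[OF u(1,2) us(2) s(1)] by (simp add: u_def)
    also have "\<beta> \<le> barrier \<alpha>"
      using M theta(1) by (simp add: field_simps)
    also have "barrier \<alpha> \<le> barrier (u s)"
      using us eq1.c_pos by (intro barrier_mono) auto
    also have "\<theta>u2 (f2 (u s)) * A s \<le> barrier (u s) * A s"
      using M_ge_1 A0 theta by (intro mult_right_mono) auto
    finally have "v s \<le> barrier (u s) * (1 + A s)"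
      by (simp add: distrib_left)
    then have "f1 (v s) \<le> f1 (barrier (u s) * (1 + A s))"
      by (intro nonneg_cont_incrD(2)[OF eq1.f] nonneg_contD(2)[OF v] s)
    also have "\<dots> \<le> cu * g (barrier (u s)) * \<xi> (1 + A s)"
      using A0 us eq1.c_pos by (intro f1_upper barrier_mono) auto
    also have "\<dots> \<le> cu * ?G * \<xi> (1 + A s)"
      using cu A0 us u(2)[OF s(2)] barrier_pos[OF us(2)]
      by (intro mult_right_mono mult_left_mono nonneg_cont_incrD(2)[OF g] barrier_mono nonneg_contD(2)[OF xi]) auto
    finally have "f1 (v s) \<le> cu * ?G * \<xi> (1 + A s)" .
    from mult_left_mono[OF this nonneg_contD(2)[OF eq1.a s(1)]] show ?thesis
      by (simp add: ac_simps)
  qed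
  then have "radial_flux N (\<lambda>s. a1 s * f1 (v s)) t \<le> radial_flux N (\<lambda>s. ?G * cu * ?b s) t"
    using G cu
    by (intro radial_flux_mono t eq1.source_continuous v nonneg_contD(1)[OF nonneg_cont_const_mult[OF _ b]]) auto
  then have "eq1.slope v t \<le> hinv \<phi>1 (?G * (cu * radial_flux N ?b t))"
    by (intro eq1.hinv_mono nonneg_contD(2)[OF eq1.flux_nonneg_cont[OF v] t])
       (simp add: radial_flux_cmult mult.assoc)
  also have "\<dots> \<le> ku1 * growth (u t) * \<psi>u1 (cu * radial_flux N ?b t)"
    using cu nonneg_contD(2)[OF nonneg_cont_radial_flux[OF eq1.N_pos b] t]
    by (intro eq1.hinv_upper G) auto
  finally show ?thesis by (simp add: u_def)
qed

text \<open>Separation of variables: $H(u)' = u'/\mathrm{growth}(u)$ is at most $k P'$ with $k$ the upper constant of the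
  first equation, and both functions vanish at 0.\<close>
lemma H_op_le_P:
  assumes v: "nonneg_cont v" and sub: "\<And>s. 0 \<le> s \<Longrightarrow> v s \<le> eq2.op (eq1.op v) s" and r: "0 \<le> r"
  shows "H (eq1.op v r) \<le> ku1 * P r"
proof -
  let ?u = "eq1.op v" and ?p = "\<lambda>t. \<psi>u1 (cu * radial_flux N (\<lambda>s. a1 s * \<xi> (1 + A s)) t)"
  let ?D = "\<lambda>t. H (?u t) - ku1 * P t"
  let ?D' = "\<lambda>t. 1 / growth (?u t) * eq1.slope v t - ku1 * ?p t"
  have der: "(?D has_real_derivative ?D' t) (at t within {0..})" if t: "0 \<le> t" for t
  proof -
    have "(H has_real_derivative 1 / growth (?u t)) (at (?u t) within ?u ` {0..})"
      by (rule DERIV_subset[OF H_has_derivative]) (use eq1.op_ge[OF v] t in auto)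
    from DERIV_image_chain[OF this eq1.op_has_derivative[OF v t]]
    have 1: "((\<lambda>t. H (?u t)) has_real_derivative 1 / growth (?u t) * eq1.slope v t) (at t within {0..})"
      by (simp add: o_def)
    have 2: "(P has_real_derivative ?p t) (at t within {0..})"
      unfolding P_fun_eq[abs_def]
      by (rule integral_has_real_derivative_atLeast[OF nonneg_contD(1)[OF P_integrand_nonneg_cont] t])
    show ?thesis
      by (rule DERIV_diff[OF 1 DERIV_cmult[OF 2]])
  qed
  have D': "?D' t \<le> 0" if t: "0 \<le> t" for t
    using slope_le_growth[OF v sub t] growth_pos[OF eq1.op_ge[OF v t]] by (simp add: field_simps)
  have "?D r \<le> ?D 0"
  proof (rule DERIV_nonpos_imp_decreasing_open[OF r])
    show "\<exists>y. DERIV ?D t :> y \<and> y \<le> 0" if "0 < t" for t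
      using der[of t] D'[of t] that by (auto simp: at_within_atLeast_interior)
    have "continuous_on {0..} ?D"
      unfolding continuous_on_eq_continuous_within using der by (blast intro: DERIV_continuous)
    then show "continuous_on {0..r} ?D"
      by (rule continuous_on_subset) auto
  qed
  also have "?D 0 = 0"
    by (simp add: H_fun_def P_fun_def)
  finally show ?thesis by simp
qed

lemma H_bounded_imp_bounded: "\<exists>B. \<forall>x. H x \<le> K \<longrightarrow> x \<le> B"
proof -
  obtain B where "\<And>x. B \<le> x \<Longrightarrow> K + 1 \<le> H x"
    using H_at_top unfolding filterlim_at_top eventually_at_top_linorder by blast
  then have "x \<le> B" if "H x \<le> K" for x
    using that by (cases "B \<le> x") force+
  then show ?thesis by blast
qed

text \<open>If $P$ stays bounded, so does $H(u)$ and hence \<open>u\<close>, because $H$ tends to infinity; \<open>u\<close> is monotone.\<close>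
lemma first_component_convergent:
  assumes v: "nonneg_cont v" and uv: "u = eq1.op v" "v = eq2.op u"
    and P: "(P \<longlongrightarrow> L) at_top"
  shows "\<exists>L. (u \<longlongrightarrow> L) at_top"
proof -
  have mono: "u r \<le> u s" if "r \<le> s" for r s
    using eq1.op_incr[OF v that] uv(1) by simp
  obtain B where B: "\<And>x. H x \<le> ku1 * (L + 1) \<Longrightarrow> x \<le> B"
    using H_bounded_imp_bounded by blast
  have "\<forall>\<^sub>F r in at_top. P r < L + 1"
    by (rule order_tendstoD(2)[OF P]) simp
  then obtain R where R: "\<And>r. R \<le> r \<Longrightarrow> P r < L + 1"
    unfolding eventually_at_top_linorder by blast
  have "u r \<le> B" if r: "0 \<le> r" for r
  proof -
    have "v s \<le> eq2.op (eq1.op v) s" for s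
      by (simp flip: uv)
    then have "H (eq1.op v (max r R)) \<le> ku1 * P (max r R)"
      using r by (intro H_op_le_P v) auto
    then have "H (u (max r R)) \<le> ku1 * P (max r R)"
      by (simp flip: uv(1))
    also have "\<dots> \<le> ku1 * (L + 1)"
      using R[of "max r R"] eq1.k_pos by (intro mult_left_mono) auto
    finally show ?thesis
      using B mono[of r "max r R"] by force
  qed
  with mono show ?thesis
    by (rule mono_bounded_tendsto_at_top)
qed

text \<open>Monotone iteration from the constant \<open>\<alpha>\<close>, which lies below every value of the first operator. The bound on
  $H$ is uniform in the index of the iterate, so that the pointwise limit is finite and locally bounded.\<close>
lemma solution_exists:
  obtains u v where "nonneg_cont u" "nonneg_cont v" "u = eq1.op v" "v = eq2.op u"
proof -
  define U where "U = rec_nat (\<lambda>_. \<alpha>) (\<lambda>_ u. eq1.op (eq2.op u))"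
  have U_0: "U 0 = (\<lambda>_. \<alpha>)" and U_Suc: "U (Suc n) = eq1.op (eq2.op (U n))" for n
    by (simp_all add: U_def)
  have U: "nonneg_cont (U n)" for n
    using eq1.c_pos by (induction n)
      (simp_all add: U_0 U_Suc nonneg_cont_const eq1.op_nonneg_cont eq2.op_nonneg_cont)
  note V = eq2.op_nonneg_cont[OF U]
  have U_le: "U n r \<le> U (Suc n) r" if "0 \<le> r" for n r
    using that
  proof (induction n arbitrary: r)
    case 0
    then show ?case using eq1.op_ge[OF V, of r 0] by (simp add: U_0 U_Suc[of 0])
  next
    case (Suc n)
    then show ?case
      unfolding U_Suc[of "Suc n"] unfolding U_Suc[of n]
      by (intro eq1.op_mono eq2.op_mono V U eq2.op_nonneg_cont eq1.op_nonneg_cont)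
         (use Suc.IH in \<open>auto simp: U_Suc\<close>)
  qed
  have U_incr: "U n r \<le> U n s" if "r \<le> s" for n r s
    by (cases n) (simp_all add: U_0 U_Suc eq1.op_incr[OF V] that)
  have bound: "\<exists>B. \<forall>n. \<forall>s\<in>{0..r}. U n s \<le> B" for r
  proof (cases "0 \<le> r")
    case True
    obtain B where B: "\<And>x. H x \<le> ku1 * P r \<Longrightarrow> x \<le> B"
      using H_bounded_imp_bounded by blast
    have "U n s \<le> B" if "s \<in> {0..r}" for n s
    proof -
      have "eq2.op (U n) s \<le> eq2.op (eq1.op (eq2.op (U n))) s" if "0 \<le> s" for s
        unfolding U_Suc[symmetric] using that U_le by (intro eq2.op_mono U) auto
      then have "U (Suc n) r \<le> B"
        unfolding U_Suc by (intro B H_op_le_P V True)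
      with U_incr[of s r n] U_le[OF True, of n] that show ?thesis by simp
    qed
    then show ?thesis by blast
  qed auto
  have "\<exists>l. (\<lambda>n. U n r) \<longlonglongrightarrow> l" if r: "0 \<le> r" for r
  proof -
    obtain B where "\<And>n. U n r \<le> B" using bound[of r] r by fastforce
    then show ?thesis
      using incseq_convergent[of "\<lambda>n. U n r" B] U_le[OF r] by (metis incseq_SucI)
  qed
  then obtain y where y: "\<And>r. 0 \<le> r \<Longrightarrow> (\<lambda>n. U n r) \<longlonglongrightarrow> y r"
    by metis
  define v where "v = eq2.op y"
  have v: "nonneg_cont v" "\<And>r. 0 \<le> r \<Longrightarrow> (\<lambda>n. eq2.op (U n) r) \<longlonglongrightarrow> v r"
    unfolding v_def using eq2.radial_op_tendsto[of U y] U y bound by blast+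
  \<comment> \<open>Locally bounded arguments have locally bounded images, since the operator preserves order.\<close>
  have V_bound: "\<exists>B. \<forall>n. \<forall>s\<in>{0..r}. eq2.op (U n) s \<le> B" for r
  proof -
    obtain B where B: "\<And>n s. s \<in> {0..r} \<Longrightarrow> U n s \<le> B" using bound by blast
    have "eq2.op (U n) s \<le> eq2.op (\<lambda>_. max 0 B) r" if s: "s \<in> {0..r}" for n s
    proof -
      have "eq2.op (U n) s \<le> eq2.op (\<lambda>_. max 0 B) s"
        using s B by (intro eq2.op_mono U nonneg_cont_const) (force simp: le_max_iff_disj)+
      also have "\<dots> \<le> eq2.op (\<lambda>_. max 0 B) r"
        using s by (intro eq2.op_incr nonneg_cont_const) auto
      finally show ?thesis .
    qed
    then show ?thesis by blast
  qed
  have u: "nonneg_cont (eq1.op v)" "\<And>r. 0 \<le> r \<Longrightarrow> (\<lambda>n. U (Suc n) r) \<longlonglongrightarrow> eq1.op v r"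
    unfolding U_Suc using eq1.radial_op_tendsto[of "\<lambda>n. eq2.op (U n)" v] V v V_bound by blast+
  have "y r = eq1.op v r" if "0 \<le> r" for r
    using LIMSEQ_unique[OF LIMSEQ_Suc[OF y[OF that]] u(2)[OF that]] .
  \<comment> \<open>The operator sees \<open>y\<close> on the half-line only, where it agrees with the continuous function \<open>eq1.op v\<close>.\<close>
  then have "v = eq2.op (eq1.op v)"
    unfolding v_def by (intro radial_op_cong) (simp add: v_def)
  with u v that show thesis by blast
qed

end

section \<open>Existence and behaviour at infinity of radial solutions\<close>

theorem theorem2p3:
  fixes N :: nat and \<alpha> \<beta> :: real
    and \<phi>1 \<phi>2 :: "real \<Rightarrow> real"
    and kl1 ku1 kl2 ku2 :: real
    and \<theta>l1 \<theta>u1 \<psi>l1 \<psi>u1 \<theta>l2 \<theta>u2 \<psi>l2 \<psi>u2 :: "real \<Rightarrow> real"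
    and a1 a2 f1 f2 g1 g2 \<xi>u1 \<xi>u2 :: "real \<Rightarrow> real"
    and M1 M2 cu1 cu2 :: real
  assumes dim: "CARD('n::finite) = N" "N \<ge> 3"
    and central: "\<alpha> > 0" "\<beta> > 0"
    and phi1: "admissible_phi \<phi>1 kl1 ku1 \<theta>l1 \<theta>u1 \<psi>l1 \<psi>u1"
    and phi2: "admissible_phi \<phi>2 kl2 ku2 \<theta>l2 \<theta>u2 \<psi>l2 \<psi>u2"
    and a: "nonneg_cont a1" "nonneg_cont a2"
    and f: "nonneg_cont_incr f1" "nonneg_cont_incr f2"
    and f0: "f1 0 * f2 0 \<ge> 0"
    and f_pos: "\<And>s1 s2. s1 > 0 \<Longrightarrow> s2 > 0 \<Longrightarrow> f1 s1 * f2 s2 > 0"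
    and M1: "M1 \<ge> max 1 (\<beta> / \<theta>u2 (f2 \<alpha>))"
    and M2: "M2 \<ge> max 1 (\<alpha> / \<theta>u1 (f1 \<beta>))"
    and cu: "cu1 > 0" "cu2 > 0"
    and g: "nonneg_cont_incr g1" "nonneg_cont_incr g2"
    and xi: "nonneg_cont \<xi>u1" "nonneg_cont \<xi>u2"
    and f1_upper: "\<And>t w. w \<ge> 1 \<Longrightarrow> t \<ge> M1 * \<theta>u2 (f2 \<alpha>) \<Longrightarrow> f1 (t * w) \<le> cu1 * g1 t * \<xi>u1 w"
    and f2_upper: "\<And>t w. w \<ge> 1 \<Longrightarrow> t \<ge> M2 * \<theta>u1 (f1 \<beta>) \<Longrightarrow> f2 (t * w) \<le> cu2 * g2 t * \<xi>u2 w"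
    and H12: "filterlim (H_fun \<alpha> \<theta>u1 g1 M1 \<theta>u2 f2) at_top at_top"
    and H21: "filterlim (H_fun \<beta> \<theta>u2 g2 M2 \<theta>u1 f1) at_top at_top"
  shows "\<exists>u v.
    solves_radial_system N \<phi>1 \<phi>2 a1 a2 f1 f2 u v \<and>
    solves_system \<phi>1 \<phi>2 a1 a2 f1 f2 (\<lambda>x :: real ^ 'n. u (norm x)) (\<lambda>x :: real ^ 'n. v (norm x)) \<and>
    (\<forall>r\<ge>0. u r > 0 \<and> v r > 0) \<and> u 0 = \<alpha> \<and> v 0 = \<beta> \<and>
    (\<forall>cl2 \<xi>l2 m2.
       cl2 > 0 \<and> nonneg_cont \<xi>l2 \<and> 0 < m2 \<and> m2 < min \<alpha> (\<theta>l1 (f1 \<beta>)) \<and>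
       (\<forall>w\<ge>1. f2 (m2 * w) \<ge> cl2 * \<xi>l2 w) \<and>
       (\<exists>L. (P_fun N \<psi>u1 cu1 a1 \<xi>u1 (A_fun N ku2 \<psi>u2 a2) \<longlongrightarrow> L) at_top) \<and>
       filterlim (P_fun N (hinv \<phi>2) cl2 a2 \<xi>l2 (A_fun N kl1 \<psi>l1 a1)) at_top at_top
       \<longrightarrow> (\<exists>L. (u \<longlongrightarrow> L) at_top) \<and> filterlim v at_top at_top) \<and>
    (\<forall>cl1 \<xi>l1 m1.
       cl1 > 0 \<and> nonneg_cont \<xi>l1 \<and> 0 < m1 \<and> m1 < min \<beta> (\<theta>l2 (f2 \<alpha>)) \<and>
       (\<forall>w\<ge>1. f1 (m1 * w) \<ge> cl1 * \<xi>l1 w) \<and>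
       filterlim (P_fun N (hinv \<phi>1) cl1 a1 \<xi>l1 (A_fun N kl2 \<psi>l2 a2)) at_top at_top \<and>
       (\<exists>L. (P_fun N \<psi>u2 cu2 a2 \<xi>u2 (A_fun N ku1 \<psi>u1 a1) \<longlongrightarrow> L) at_top)
       \<longrightarrow> filterlim u at_top at_top \<and> (\<exists>L. (v \<longlongrightarrow> L) at_top))"
proof -
  have f1_pos: "0 < f1 s" if "0 < s" for s
    using f_pos[OF that that] nonneg_cont_incrD(3)[OF f(1), of s] that
    by (simp add: zero_less_mult_iff)
  have f2_pos: "0 < f2 s" if "0 < s" for s
    using f_pos[OF that that] nonneg_cont_incrD(3)[OF f(2), of s] that
    by (simp add: zero_less_mult_iff)
  have N1: "1 \<le> N" using dim(2) by simp
  interpret p12: dominated_pair N \<phi>1 kl1 ku1 \<theta>l1 \<theta>u1 \<psi>l1 \<psi>u1 a1 f1 \<alpha>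
      \<phi>2 kl2 ku2 \<theta>l2 \<theta>u2 \<psi>l2 \<psi>u2 a2 f2 \<beta> M1 cu1 g1 \<xi>u1
    by unfold_locales (fact phi1 phi2 N1 a f f1_pos f2_pos central M1 cu g xi f1_upper H12)+
  interpret p21: dominated_pair N \<phi>2 kl2 ku2 \<theta>l2 \<theta>u2 \<psi>l2 \<psi>u2 a2 f2 \<beta>
      \<phi>1 kl1 ku1 \<theta>l1 \<theta>u1 \<psi>l1 \<psi>u1 a1 f1 \<alpha> M2 cu2 g2 \<xi>u2
    by unfold_locales (fact M2 cu g xi f2_upper H21)+
  obtain u v where u: "nonneg_cont u" and v: "nonneg_cont v"
    and uv: "u = p12.eq1.op v" "v = p12.eq2.op u"
    by (rule p12.solution_exists)
  have radial: "solves_radial_system N \<phi>1 \<phi>2 a1 a2 f1 f2 u v"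
    unfolding solves_radial_system_def
    using p12.eq1.op_solves_radial[OF v, folded uv(1)] p12.eq2.op_solves_radial[OF u, folded uv(2)]
    by (intro exI[of _ "p12.eq1.slope v"] exI[of _ "p12.eq2.slope u"]) simp
  have system: "solves_system \<phi>1 \<phi>2 a1 a2 f1 f2 (\<lambda>x :: real ^ 'n. u (norm x)) (\<lambda>x :: real ^ 'n. v (norm x))"
    unfolding solves_system_def
    using p12.eq1.op_solves_PDE[OF v dim(1), folded uv(1)] p12.eq2.op_solves_PDE[OF u dim(1), folded uv(2)]
    by simp
  have init: "u 0 = \<alpha>" "v 0 = \<beta>"
    by (subst uv, rule p12.eq1.op_0) (subst uv(2), rule p12.eq2.op_0)
  have pos: "0 < u r \<and> 0 < v r" if "0 \<le> r" for r
    using p12.eq1.op_ge[OF v that, folded uv(1)] p12.eq2.op_ge[OF u that, folded uv(2)] central by simp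
  have limits1: "(\<exists>L. (u \<longlongrightarrow> L) at_top) \<and> filterlim v at_top at_top"
    if "cl2 > 0" "nonneg_cont \<xi>l2" "0 < m2" "m2 < min \<alpha> (\<theta>l1 (f1 \<beta>))"
      "\<forall>w\<ge>1. cl2 * \<xi>l2 w \<le> f2 (m2 * w)"
      "\<exists>L. (P_fun N \<psi>u1 cu1 a1 \<xi>u1 (A_fun N ku2 \<psi>u2 a2) \<longlongrightarrow> L) at_top"
      "filterlim (P_fun N (hinv \<phi>2) cl2 a2 \<xi>l2 (A_fun N kl1 \<psi>l1 a1)) at_top at_top"
    for cl2 \<xi>l2 m2
    using p12.first_component_convergent[OF v uv] p12.second_component_at_top[OF u v uv that(1-4) that(5)[rule_format] that(7)] that(6)
    by blast
  have limits2: "filterlim u at_top at_top \<and> (\<exists>L. (v \<longlongrightarrow> L) at_top)"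
    if "cl1 > 0" "nonneg_cont \<xi>l1" "0 < m1" "m1 < min \<beta> (\<theta>l2 (f2 \<alpha>))"
      "\<forall>w\<ge>1. cl1 * \<xi>l1 w \<le> f1 (m1 * w)"
      "filterlim (P_fun N (hinv \<phi>1) cl1 a1 \<xi>l1 (A_fun N kl2 \<psi>l2 a2)) at_top at_top"
      "\<exists>L. (P_fun N \<psi>u2 cu2 a2 \<xi>u2 (A_fun N ku1 \<psi>u1 a1) \<longlongrightarrow> L) at_top"
    for cl1 \<xi>l1 m1
    using p21.first_component_convergent[OF u uv(2,1)] p21.second_component_at_top[OF v u uv(2,1) that(1-4) that(5)[rule_format] that(6)] that(7)
    by blast
  show ?thesis
    by (rule exI[of _ u], rule exI[of _ v], intro conjI radial system init)
      (intro allI impI, (elim conjE)?, (rule pos limits1 limits2; assumption))+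
qed

end
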